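(* Let $G$ and $H$ be finite graphs such that $G$ has at least one edge and $H$ has at least one vertex. Then \[ R(G\to H)=\inf_\eta \frac{\log\eta(G)}{\log\eta(H)}, \] where $\eta$ ranges over all semiring-homomorphic graph invariants and $R(G\to H):=\sup\{\, m/n : m,n\in\mathbb{N}_+,\ H^{\ast m}\to G^{\ast n}\,\}$.
   Context: Graphs are finite undirected simple graphs. $G\to H$ denotes existence of a graph homomorphism (a vertex map sending adjacent vertices to adjacent vertices). The join $G+H$ is the disjoint union with all edges between the two parts added. The disjunctive product $G\ast H$ has vertex set $V(G)\times V(H)$ with $(v,w)\sim(v',w')$ iff $v\sim v'$ or $w\sim w'$; $G^{\ast n}$ is the $n$-fold disjunctive power. A semiring-homomorphic graph invariant is a map $\eta$ from isomorphism classes of finite graphs to $\mathbb{R}_{\ge0}$ such that $\eta(K_1)=1$, $\eta(G)\le\eta(H)$ whenever $G\to H$, $\eta(G+H)=\eta(G)+\eta(H)$, and $\eta(G\ast H)=\eta(G)\eta(H)$. *)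

theory Defs
  imports "HOL-Library.Extended_Real" "Graph_Theory.Graph_Theory"
begin

text \<open>
  A finite undirected simple graph is a \<^const>\<open>pair_graph\<close>, i.e. a finite, symmetric,
  loop-free arc relation; every edge is present as two opposite arcs. The graph without vertices
  is included. Isomorphism is \<^const>\<open>digraph_iso\<close> along \<^const>\<open>with_proj\<close>.
\<close>

definition graph_hom_exists :: "'a pair_pre_digraph \<Rightarrow> 'b pair_pre_digraph \<Rightarrow> bool" where
  "graph_hom_exists G H \<longleftrightarrow>
     (\<exists>f. (\<forall>v \<in> pverts G. f v \<in> pverts H) \<and> (\<forall>(u, v) \<in> parcs G. (f u, f v) \<in> parcs H))"

definition graph_join ::
    "'a pair_pre_digraph \<Rightarrow> 'b pair_pre_digraph \<Rightarrow> ('a + 'b) pair_pre_digraph" where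
  "graph_join G H = \<lparr>
     pverts = pverts G <+> pverts H,
     parcs = map_prod Inl Inl ` parcs G \<union> map_prod Inr Inr ` parcs H
       \<union> (Inl ` pverts G) \<times> (Inr ` pverts H) \<union> (Inr ` pverts H) \<times> (Inl ` pverts G) \<rparr>"

definition disj_prod ::
    "'a pair_pre_digraph \<Rightarrow> 'b pair_pre_digraph \<Rightarrow> ('a \<times> 'b) pair_pre_digraph" where
  "disj_prod G H = \<lparr>
     pverts = pverts G \<times> pverts H,
     parcs = {((v, w), (v', w')) | v w v' w'.
       v \<in> pverts G \<and> v' \<in> pverts G \<and> w \<in> pverts H \<and> w' \<in> pverts H \<and>
       ((v, v') \<in> parcs G \<or> (w, w') \<in> parcs H)} \<rparr>"

text \<open>
  The type of an iterated binary product depends on the number of factors, so the vertices of the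
  \<open>n\<close>-fold power are taken to be lists of length \<open>n\<close>; cf. \<open>disj_power_Suc_iso\<close> below.
\<close>

definition disj_power :: "'a pair_pre_digraph \<Rightarrow> nat \<Rightarrow> 'a list pair_pre_digraph" where
  "disj_power G n = \<lparr>
     pverts = {xs. length xs = n \<and> set xs \<subseteq> pverts G},
     parcs = {(xs, ys). length xs = n \<and> set xs \<subseteq> pverts G \<and> length ys = n \<and> set ys \<subseteq> pverts G \<and>
       (\<exists>i < n. (xs ! i, ys ! i) \<in> parcs G)} \<rparr>"

text \<open>
  A map on isomorphism classes of finite graphs is represented by an isomorphism-invariant map on
  graphs with vertices in \<^typ>\<open>nat\<close>, since each class has such a representative. Its value at a
  graph over an arbitrary vertex type is its value at any isomorphic copy over \<^typ>\<open>nat\<close>.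
  Values outside \<^const>\<open>pair_graph\<close> are unconstrained and never used.
\<close>

definition nat_copy :: "'a pair_pre_digraph \<Rightarrow> nat pair_pre_digraph" where
  "nat_copy G = (SOME N. pair_graph N \<and> digraph_iso (with_proj G) (with_proj N))"

definition inv_value :: "(nat pair_pre_digraph \<Rightarrow> real) \<Rightarrow> 'a pair_pre_digraph \<Rightarrow> real" where
  "inv_value \<eta> G = \<eta> (nat_copy G)"

locale semiring_hom_invariant =
  fixes \<eta> :: "nat pair_pre_digraph \<Rightarrow> real"
  assumes iso_invariant:
      "\<And>G H. pair_graph G \<Longrightarrow> pair_graph H \<Longrightarrow> digraph_iso (with_proj G) (with_proj H) \<Longrightarrow> \<eta> G = \<eta> H"
    and nonneg: "\<And>G. pair_graph G \<Longrightarrow> 0 \<le> \<eta> G"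
    and K1: "\<And>G. complete_digraph 1 (with_proj G) \<Longrightarrow> \<eta> G = 1"
    and hom_mono:
      "\<And>G H. pair_graph G \<Longrightarrow> pair_graph H \<Longrightarrow> graph_hom_exists G H \<Longrightarrow> \<eta> G \<le> \<eta> H"
    and join: "\<And>G H. pair_graph G \<Longrightarrow> pair_graph H \<Longrightarrow> inv_value \<eta> (graph_join G H) = \<eta> G + \<eta> H"
    and disj: "\<And>G H. pair_graph G \<Longrightarrow> pair_graph H \<Longrightarrow> inv_value \<eta> (disj_prod G H) = \<eta> G * \<eta> H"

text \<open>\<open>hom_rate G H\<close> is $R(G \to H)$; it is infinite when \<open>H\<close> has no edges and \<open>G\<close> has a vertex.\<close>

definition hom_rate :: "'a pair_pre_digraph \<Rightarrow> 'b pair_pre_digraph \<Rightarrow> ereal" where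
  "hom_rate G H = Sup {ereal (real m / real n) | m n.
     0 < m \<and> 0 < n \<and> graph_hom_exists (disj_power H m) (disj_power G n)}"

lemma pair_graph_iff:
  "pair_graph G \<longleftrightarrow> finite (pverts G) \<and> parcs G \<subseteq> pverts G \<times> pverts G \<and> sym (parcs G) \<and>
     (\<forall>v. (v, v) \<notin> parcs G)"
proof
  assume "pair_graph G"
  then interpret pair_graph G .
  show "finite (pverts G) \<and> parcs G \<subseteq> pverts G \<times> pverts G \<and> sym (parcs G) \<and>
     (\<forall>v. (v, v) \<notin> parcs G)"
  proof (intro conjI)
    show "sym (parcs G)" by (rule symI) (rule arcs_symmetric)
    show "\<forall>v. (v, v) \<notin> parcs G" using no_loops' by blast
  qed (auto simp: pair_finite_verts dest: in_arcsD1 in_arcsD2)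
next
  assume A: "finite (pverts G) \<and> parcs G \<subseteq> pverts G \<times> pverts G \<and> sym (parcs G) \<and>
     (\<forall>v. (v, v) \<notin> parcs G)"
  then have "finite (parcs G)" by (meson finite_SigmaI finite_subset)
  with A show "pair_graph G"
    by unfold_locales (auto simp: symmetric_def)
qed

lemma digraph_iso_pair_iff:
  assumes G: "pair_wf_digraph G" and H: "pair_wf_digraph H"
  shows "digraph_iso (with_proj G) (with_proj H) \<longleftrightarrow>
    (\<exists>f. bij_betw f (pverts G) (pverts H) \<and>
      (\<forall>u \<in> pverts G. \<forall>v \<in> pverts G. (u, v) \<in> parcs G \<longleftrightarrow> (f u, f v) \<in> parcs H))"
    (is "?L \<longleftrightarrow> ?R")
proof
  assume ?L
  then obtain h where h: "pre_digraph.digraph_isomorphism (with_proj G) h"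
    and eq: "with_proj H = app_iso h (with_proj G)"
    by (auto simp: digraph_iso_def)
  let ?f = "iso_verts h"
  from arg_cong[OF eq, of verts] arg_cong[OF eq, of arcs] arg_cong[OF eq, of tail]
    arg_cong[OF eq, of head]
  have V: "pverts H = ?f ` pverts G" and A: "parcs H = iso_arcs h ` parcs G"
    and t: "iso_tail h = fst" and hd: "iso_head h = snd"
    by simp_all
  have inj: "inj_on ?f (pverts G)"
    and ia: "\<And>a. a \<in> parcs G \<Longrightarrow> iso_arcs h a = (?f (fst a), ?f (snd a))"
    using h by (auto simp: pre_digraph.digraph_isomorphism_def t hd prod_eq_iff)
  interpret pair_wf_digraph G by fact
  have "(u, v) \<in> parcs G" if "u \<in> pverts G" "v \<in> pverts G" "(?f u, ?f v) \<in> parcs H" for u v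
  proof -
    from that(3) obtain a where a: "a \<in> parcs G" "(?f u, ?f v) = iso_arcs h a"
      by (auto simp: A)
    then have "?f u = ?f (fst a)" "?f v = ?f (snd a)" using ia by auto
    then have "u = fst a" "v = snd a"
      using inj that a(1) arc_fst_in_verts arc_snd_in_verts by (auto dest: inj_onD)
    with a show ?thesis by simp
  qed
  moreover have "(?f u, ?f v) \<in> parcs H" if "(u, v) \<in> parcs G" for u v
    using ia[OF that] that unfolding A by (metis fst_conv imageI snd_conv)
  ultimately show ?R using inj V by (intro exI[of _ ?f]) (auto simp: bij_betw_def)
next
  assume ?R
  then obtain f where f: "bij_betw f (pverts G) (pverts H)"
    and e: "\<And>u v. u \<in> pverts G \<Longrightarrow> v \<in> pverts G \<Longrightarrow> (u, v) \<in> parcs G \<longleftrightarrow> (f u, f v) \<in> parcs H"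
    by blast
  interpret G: pair_wf_digraph G by fact
  interpret H: pair_wf_digraph H by fact
  let ?h = "\<lparr>iso_verts = f, iso_arcs = map_prod f f, iso_head = snd, iso_tail = fst\<rparr>"
  have "inj_on (map_prod f f) (pverts G \<times> pverts G)"
    using f by (auto simp: bij_betw_def intro: map_prod_inj_on)
  then have "inj_on (map_prod f f) (parcs G)"
    by (rule inj_on_subset) (auto dest: G.in_arcsD1 G.in_arcsD2)
  then have 1: "pre_digraph.digraph_isomorphism (with_proj G) ?h"
    using f G.wf_digraph by (auto simp: pre_digraph.digraph_isomorphism_def bij_betw_def)
  have "parcs H = map_prod f f ` parcs G"
  proof (intro equalityI subsetI)
    fix a assume a: "a \<in> parcs H"
    then have "fst a \<in> f ` pverts G" "snd a \<in> f ` pverts G"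
      using bij_betw_imp_surj_on[OF f] H.arc_fst_in_verts H.arc_snd_in_verts by auto
    then obtain u v where uv: "u \<in> pverts G" "v \<in> pverts G" "fst a = f u" "snd a = f v"
      by blast
    then have auv: "a = (f u, f v)" by (simp add: prod_eq_iff)
    have "(u, v) \<in> parcs G" using a e uv(1,2) unfolding auv by blast
    then show "a \<in> map_prod f f ` parcs G" unfolding auv by force
  next
    fix a assume "a \<in> map_prod f f ` parcs G"
    then show "a \<in> parcs H" using e by (auto dest: G.in_arcsD1 G.in_arcsD2)
  qed
  then have "with_proj H = app_iso ?h (with_proj G)"
    using f by (auto simp: with_proj_def app_iso_def bij_betw_def)
  with 1 show ?L unfolding digraph_iso_def by blast
qed

lemma pair_graph_wf: "pair_graph G \<Longrightarrow> pair_wf_digraph G"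
  by (simp add: pair_graph_def pair_digraph_def pair_fin_digraph_def)

lemma nat_copy:
  assumes "pair_graph G"
  shows "pair_graph (nat_copy G)" "digraph_iso (with_proj G) (with_proj (nat_copy G))"
proof -
  interpret pair_graph G by fact
  obtain f :: "'a \<Rightarrow> nat" where f: "inj_on f (pverts G)"
    using finite_imp_inj_to_nat_seg[OF pair_finite_verts] by blast
  let ?N = "\<lparr>pverts = f ` pverts G, parcs = map_prod f f ` parcs G\<rparr>"
  have N: "pair_graph ?N"
    unfolding pair_graph_iff
  proof (intro conjI)
    show "finite (pverts ?N)" using pair_finite_verts by simp
    show "parcs ?N \<subseteq> pverts ?N \<times> pverts ?N" by (auto dest: in_arcsD1 in_arcsD2)
    show "sym (parcs ?N)"
    proof (rule symI)
      fix x y assume "(x, y) \<in> parcs ?N"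
      then obtain u v where "(u, v) \<in> parcs G" "x = f u" "y = f v" by auto
      then show "(y, x) \<in> parcs ?N" using arcs_symmetric by force
    qed
    show "\<forall>v. (v, v) \<notin> parcs ?N"
    proof (intro allI notI)
      fix x assume "(x, x) \<in> parcs ?N"
      then obtain u v where uv: "(u, v) \<in> parcs G" "f u = f v" by auto
      then have "u = v" using inj_onD[OF f] in_arcsD1 in_arcsD2 by metis
      with uv show False using no_loops' by blast
    qed
  qed
  have "bij_betw f (pverts G) (pverts ?N)" using f by (simp add: bij_betw_def)
  moreover have "(u, v) \<in> parcs G \<longleftrightarrow> (f u, f v) \<in> parcs ?N"
    if "u \<in> pverts G" "v \<in> pverts G" for u v
  proof
    assume "(u, v) \<in> parcs G" then show "(f u, f v) \<in> parcs ?N" by force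
  next
    assume "(f u, f v) \<in> parcs ?N"
    then obtain u' v' where uv: "(u', v') \<in> parcs G" "f u = f u'" "f v = f v'" by auto
    then have "u = u'" "v = v'" using that inj_onD[OF f] in_arcsD1 in_arcsD2 by metis+
    with uv show "(u, v) \<in> parcs G" by simp
  qed
  ultimately have "digraph_iso (with_proj G) (with_proj ?N)"
    using digraph_iso_pair_iff[OF pair_graph_wf[OF assms] pair_graph_wf[OF N]] by blast
  with N have "\<exists>N :: nat pair_pre_digraph. pair_graph N \<and> digraph_iso (with_proj G) (with_proj N)"
    by blast
  from someI_ex[OF this]
  show "pair_graph (nat_copy G)" "digraph_iso (with_proj G) (with_proj (nat_copy G))"
    by (simp_all add: nat_copy_def)
qed

lemma pair_graph_join: "pair_graph G \<Longrightarrow> pair_graph H \<Longrightarrow> pair_graph (graph_join G H)"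
  by (auto simp: pair_graph_iff graph_join_def sym_def)

lemma pair_graph_disj_prod: "pair_graph G \<Longrightarrow> pair_graph H \<Longrightarrow> pair_graph (disj_prod G H)"
  by (auto simp: pair_graph_iff disj_prod_def sym_def)

lemma pair_graph_disj_power: "pair_graph G \<Longrightarrow> pair_graph (disj_power G n)"
  using finite_lists_length_eq[of "pverts G" n]
  by (auto simp: pair_graph_iff disj_power_def sym_def conj_commute)

lemma disj_power_1_iso:
  assumes "pair_graph G"
  shows "digraph_iso (with_proj G) (with_proj (disj_power G 1))"
proof -
  have "bij_betw (\<lambda>v. [v]) (pverts G) (pverts (disj_power G 1))"
    by (rule bij_betw_byWitness[where f' = hd])
      (auto simp: disj_power_def length_Suc_conv)
  then show ?thesis
    unfolding digraph_iso_pair_iff[OF pair_graph_wf[OF assms]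
        pair_graph_wf[OF pair_graph_disj_power[OF assms]]]
    by (intro exI[of _ "\<lambda>v. [v]"]) (auto simp: disj_power_def)
qed

lemma disj_power_Suc_iso:
  assumes "pair_graph G"
  shows "digraph_iso (with_proj (disj_prod G (disj_power G n))) (with_proj (disj_power G (Suc n)))"
proof -
  let ?f = "\<lambda>(v, w). v # w"
  have "bij_betw ?f (pverts (disj_prod G (disj_power G n))) (pverts (disj_power G (Suc n)))"
    by (rule bij_betw_byWitness[where f' = "\<lambda>xs. (hd xs, tl xs)"])
      (auto simp: disj_power_def disj_prod_def length_Suc_conv)
  then show ?thesis
    unfolding digraph_iso_pair_iff[OF
        pair_graph_wf[OF pair_graph_disj_prod[OF assms pair_graph_disj_power[OF assms]]]
        pair_graph_wf[OF pair_graph_disj_power[OF assms]]]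
    by (intro exI[of _ ?f]) (auto simp: disj_power_def disj_prod_def less_Suc_eq_0_disj)
qed

lemma (in semiring_hom_invariant) inv_value_eq:
  assumes "pair_graph G" "pair_graph N" "digraph_iso (with_proj G) (with_proj N)"
  shows "inv_value \<eta> G = \<eta> N"
proof -
  note wf = assms(1,2)[THEN pair_graph_wf] nat_copy(1)[OF assms(1), THEN pair_graph_wf]
  obtain f where f: "bij_betw f (pverts G) (pverts N)"
    "\<forall>u \<in> pverts G. \<forall>v \<in> pverts G. (u, v) \<in> parcs G \<longleftrightarrow> (f u, f v) \<in> parcs N"
    using assms(3) digraph_iso_pair_iff[OF wf(1,2)] by blast
  obtain g where g: "bij_betw g (pverts G) (pverts (nat_copy G))"
    "\<forall>u \<in> pverts G. \<forall>v \<in> pverts G. (u, v) \<in> parcs G \<longleftrightarrow> (g u, g v) \<in> parcs (nat_copy G)"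
    using nat_copy(2)[OF assms(1)] digraph_iso_pair_iff[OF wf(1,3)] by blast
  let ?i = "the_inv_into (pverts G) g"
  have i: "bij_betw ?i (pverts (nat_copy G)) (pverts G)"
    using g(1) by (rule bij_betw_the_inv_into)
  have gi: "g (?i x) = x" if "x \<in> pverts (nat_copy G)" for x
    using that g(1) by (simp add: f_the_inv_into_f_bij_betw)
  have "bij_betw (f \<circ> ?i) (pverts (nat_copy G)) (pverts N)"
    using i f(1) by (rule bij_betw_trans)
  moreover have "(x, y) \<in> parcs (nat_copy G) \<longleftrightarrow> ((f \<circ> ?i) x, (f \<circ> ?i) y) \<in> parcs N"
    if "x \<in> pverts (nat_copy G)" "y \<in> pverts (nat_copy G)" for x y
    using that f(2) g(2) gi bij_betwE[OF i] by (metis comp_apply)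
  ultimately have "digraph_iso (with_proj (nat_copy G)) (with_proj N)"
    using digraph_iso_pair_iff[OF wf(3,2)] by blast
  then show ?thesis
    unfolding inv_value_def using iso_invariant nat_copy(1) assms by blast
qed

end

theory Submission
  imports Defs "HOL-Real_Asymp.Real_Asymp"
begin

section \<open>Semiring preorders and their real spectrum\<close>

text \<open>
  Up to homomorphic equivalence, finite graphs form a commutative semiring under join and
  disjunctive product, preordered by existence of homomorphisms, and the graph invariants are
  exactly its monotone homomorphisms to the reals. Following Strassen, given \<open>a\<close> and \<open>b\<close> one
  adjoins the relation \<open>a \<le> b\<close> to the preorder. If this does not collapse it, Zorn's lemma
  yields a total extension, in which comparison with rational numbers defines a monotone
  homomorphism \<open>\<phi>\<close> with \<open>\<phi> a \<le> \<phi> b\<close>. If it collapses, there are \<open>c\<close> and \<open>s\<close> with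
  \<open>c + 1 + s b \<le> c + s a\<close>, and hence \<open>b ^ k\<close> lies below \<open>a ^ k\<close> up to a subexponential factor.
  For \<open>a = G ^ n\<close> and \<open>b = H ^ m\<close> this factor is absorbed by a few more copies of \<open>G\<close>, because
  \<open>G\<close> has an edge; so \<open>m / n\<close> is at most the rate.
\<close>

text \<open>\<open>upper\<close> and \<open>lower\<close> are Strassen's Archimedean conditions.
  Collapse means \<open>a + 1\<close> below \<open>a\<close>; it is excluded for every
  \<open>a\<close>, not just for naturals, so that a failure after adjoining a relation is directly
  an inequality with some \<open>c\<close> and \<open>s\<close>.\<close>

locale strassen_preorder =
  fixes R :: "'a::comm_semiring_1 rel"
  assumes refl: "(a, a) \<in> R"
    and trans: "(a, b) \<in> R \<Longrightarrow> (b, c) \<in> R \<Longrightarrow> (a, c) \<in> R"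
    and add_right: "(a, b) \<in> R \<Longrightarrow> (a + c, b + c) \<in> R"
    and mult_right: "(a, b) \<in> R \<Longrightarrow> (a * c, b * c) \<in> R"
    and zero_le_one: "(0, 1) \<in> R"
    and upper: "\<exists>n. (a, of_nat n) \<in> R"
    and lower: "a \<noteq> 0 \<Longrightarrow> \<exists>n. (1, of_nat n * a) \<in> R"
    and not_succ_le: "(a + 1, a) \<notin> R"
begin

abbreviation le (infix "\<preceq>" 50) where "a \<preceq> b \<equiv> (a, b) \<in> R"

lemma add_mono: "a \<preceq> b \<Longrightarrow> c \<preceq> d \<Longrightarrow> a + c \<preceq> b + d"
  using add_right[of a b c] add_right[of c d b] trans by (metis add.commute)

lemma mult_left: "a \<preceq> b \<Longrightarrow> c * a \<preceq> c * b"
  using mult_right[of a b c] by (simp add: mult.commute)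

lemma mult_mono: "a \<preceq> b \<Longrightarrow> c \<preceq> d \<Longrightarrow> a * c \<preceq> b * d"
  using mult_right[of a b c] mult_left[of c d b] trans by blast

lemma power_mono: "a \<preceq> b \<Longrightarrow> a ^ n \<preceq> b ^ n"
  by (induction n) (auto intro: refl mult_mono)

lemma zero_le: "0 \<preceq> a"
  using mult_right[OF zero_le_one, of a] by simp

lemma le_add: "a \<preceq> a + b"
  using add_mono[OF refl[of a] zero_le[of b]] by simp

lemma of_nat_mono: "m \<le> n \<Longrightarrow> of_nat m \<preceq> of_nat n"
  using le_add[of "of_nat m" "of_nat (n - m)"] by (metis le_add_diff_inverse of_nat_add)

lemma of_nat_le_iff: "of_nat m \<preceq> of_nat n \<longleftrightarrow> m \<le> n"
proof
  assume *: "of_nat m \<preceq> of_nat n"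
  show "m \<le> n"
  proof (rule ccontr)
    assume "\<not> m \<le> n"
    then have "of_nat (Suc n) \<preceq> of_nat m" by (intro of_nat_mono) simp
    with * have "of_nat (Suc n) \<preceq> of_nat n" using trans by blast
    then show False using not_succ_le[of "of_nat n"] by (simp add: add.commute)
  qed
qed (rule of_nat_mono)

text \<open>Multiplying by an \<open>r\<close> with \<open>1\<close> below \<open>r * s\<close>
  turns a gain of \<open>s\<close> into a gain of at least \<open>1\<close>, which
  \<open>not_succ_le\<close> forbids.\<close>

lemma not_add_le:
  assumes "s \<noteq> 0"
  shows "\<not> c + s \<preceq> c"
proof
  assume "c + s \<preceq> c"
  obtain r where "1 \<preceq> of_nat r * s" using lower assms by blast
  then have "of_nat r * c + 1 \<preceq> of_nat r * c + of_nat r * s" by (rule add_mono[OF refl])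
  also have "of_nat r * c + of_nat r * s = of_nat r * (c + s)" by (simp add: algebra_simps)
  finally have "of_nat r * c + 1 \<preceq> of_nat r * c"
    using mult_left[OF \<open>c + s \<preceq> c\<close>] trans by metis
  then show False using not_succ_le by blast
qed

end

text \<open>The defining condition is \<open>y - x \<ge> s * (b - a)\<close>, with the terms moved so that no
  subtraction occurs.\<close>

definition adjoin :: "'a::comm_semiring_1 rel \<Rightarrow> 'a \<Rightarrow> 'a \<Rightarrow> 'a rel" where
  "adjoin R a b = {(x, y). \<exists>s. (x + s * b, y + s * a) \<in> R}"

section \<open>Adjoining relations and total extensions\<close>

context strassen_preorder
begin

lemma subset_adjoin: "R \<subseteq> adjoin R a b"
  by (auto simp: adjoin_def intro!: exI[of _ 0])

lemma mem_adjoin: "(a, b) \<in> adjoin R a b"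
  by (auto simp: adjoin_def add.commute intro!: exI[of _ 1] refl)

text \<open>Transitivity adds the multipliers \<open>s\<close>, and multiplication by
  \<open>z\<close> multiplies them by \<open>z\<close>. The existence axioms persist in any larger
  relation, and \<open>not_succ_le\<close> unfolds to the hypothesis.\<close>

lemma strassen_preorder_adjoin:
  assumes nondegenerate: "\<And>c s. \<not> c + 1 + s * b \<preceq> c + s * a"
  shows "strassen_preorder (adjoin R a b)"
proof
  show "(x, x) \<in> adjoin R a b" for x using subset_adjoin refl by blast
  show "(x, z) \<in> adjoin R a b" if xy: "(x, y) \<in> adjoin R a b" and yz: "(y, z) \<in> adjoin R a b" for x y z
  proof -
    obtain s t where s: "x + s * b \<preceq> y + s * a" and t: "y + t * b \<preceq> z + t * a"
      using xy yz by (auto simp: adjoin_def)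
    have "x + (s + t) * b \<preceq> y + s * a + t * b"
      using add_right[OF s, of "t * b"] by (simp add: algebra_simps)
    moreover have "y + s * a + t * b \<preceq> z + (s + t) * a"
      using add_right[OF t, of "s * a"] by (simp add: algebra_simps)
    ultimately show ?thesis using trans by (auto simp: adjoin_def)
  qed
  show "(x + z, y + z) \<in> adjoin R a b" if xy: "(x, y) \<in> adjoin R a b" for x y z
  proof -
    obtain s where s: "x + s * b \<preceq> y + s * a"
      using xy by (auto simp: adjoin_def)
    have "(x + z) + s * b \<preceq> (y + z) + s * a"
      using add_right[OF s, of z] by (simp add: algebra_simps)
    then show ?thesis by (auto simp: adjoin_def)
  qed
  show "(x * z, y * z) \<in> adjoin R a b" if xy: "(x, y) \<in> adjoin R a b" for x y z
  proof -
    obtain s where s: "x + s * b \<preceq> y + s * a"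
      using xy by (auto simp: adjoin_def)
    have "x * z + (s * z) * b \<preceq> y * z + (s * z) * a"
      using mult_right[OF s, of z] by (simp add: algebra_simps)
    then show ?thesis by (auto simp: adjoin_def)
  qed
  show "(0, 1) \<in> adjoin R a b" using subset_adjoin zero_le_one by blast
  show "\<exists>n. (x, of_nat n) \<in> adjoin R a b" for x using subset_adjoin upper by blast
  show "\<exists>n. (1, of_nat n * x) \<in> adjoin R a b" if "x \<noteq> 0" for x
    using subset_adjoin lower[OF that] by blast
  show "(x + 1, x) \<notin> adjoin R a b" for x
    using nondegenerate by (auto simp: adjoin_def)
qed

text \<open>Multiply the two inequalities by \<open>t\<close> and \<open>s\<close> and add: the
  mixed products occur on both sides, so \<open>?e + s + t\<close> lies below the common part
  \<open>?e\<close>.\<close>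

lemma degenerate_antisym:
  assumes "c + 1 + s * b \<preceq> c + s * a"
  shows "\<not> d + 1 + t * a \<preceq> d + t * b"
proof
  assume *: "d + 1 + t * a \<preceq> d + t * b"
  have "s \<noteq> 0"
    using assms not_succ_le[of c] by auto
  let ?e = "c * t + d * s + s * t * a + s * t * b"
  have "(c + 1 + s * b) * t + (d + 1 + t * a) * s \<preceq> (c + s * a) * t + (d + t * b) * s"
    by (intro add_mono mult_right assms *)
  then have "?e + s + t \<preceq> ?e" by (simp add: algebra_simps)
  with le_add have "?e + s \<preceq> ?e" by (rule trans)
  then show False using not_add_le[OF \<open>s \<noteq> 0\<close>] by blast
qed

text \<open>In a maximal extension every pair whose adjunction does not collapse is already present,
  and by \<open>degenerate_antisym\<close> this covers at least one orientation of each
  pair.\<close>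

lemma ex_total_extension:
  obtains Q where "R \<subseteq> Q" "strassen_preorder Q" "\<And>a b. (a, b) \<in> Q \<or> (b, a) \<in> Q"
proof -
  let ?A = "{Q. R \<subseteq> Q \<and> strassen_preorder Q}"
  have "\<exists>M\<in>?A. \<forall>X\<in>?A. M \<subseteq> X \<longrightarrow> X = M"
  proof (rule subset_Zorn_nonempty)
    show "?A \<noteq> {}" using strassen_preorder_axioms by blast
    fix C assume C: "C \<noteq> {}" and ch: "subset.chain ?A C"
    then have sub: "\<And>Q. Q \<in> C \<Longrightarrow> R \<subseteq> Q" and st: "\<And>Q. Q \<in> C \<Longrightarrow> strassen_preorder Q"
      and lin: "\<And>P Q. P \<in> C \<Longrightarrow> Q \<in> C \<Longrightarrow> P \<subseteq> Q \<or> Q \<subseteq> P"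
      unfolding subset.chain_def by blast+
    have R: "R \<subseteq> \<Union>C" using C sub by blast
    have "strassen_preorder (\<Union>C)"
    proof
      show "(x, x) \<in> \<Union>C" for x using R refl by blast
      show "(x, z) \<in> \<Union>C" if xy: "(x, y) \<in> \<Union>C" and yz: "(y, z) \<in> \<Union>C" for x y z
      proof -
        obtain P Q where PQ: "P \<in> C" "Q \<in> C" "(x, y) \<in> P" "(y, z) \<in> Q" using xy yz by blast
        then have "(x, z) \<in> P \<or> (x, z) \<in> Q"
          using lin[OF PQ(1,2)] st strassen_preorder.trans by blast
        with PQ show ?thesis by blast
      qed
      show "(x + z, y + z) \<in> \<Union>C" if "(x, y) \<in> \<Union>C" for x y z
        using that st strassen_preorder.add_right by blast
      show "(x * z, y * z) \<in> \<Union>C" if "(x, y) \<in> \<Union>C" for x y z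
        using that st strassen_preorder.mult_right by blast
      show "(0, 1) \<in> \<Union>C" using R zero_le_one by blast
      show "\<exists>n. (x, of_nat n) \<in> \<Union>C" for x using R upper by blast
      show "\<exists>n. (1, of_nat n * x) \<in> \<Union>C" if "x \<noteq> 0" for x using R lower[OF that] by blast
      show "(x + 1, x) \<notin> \<Union>C" for x using st strassen_preorder.not_succ_le by blast
    qed
    with R show "\<Union>C \<in> ?A" by blast
  qed
  then obtain Q where "Q \<in> ?A" and max: "\<forall>X\<in>?A. Q \<subseteq> X \<longrightarrow> X = Q" by (rule bexE)
  then have RQ: "R \<subseteq> Q" and Q: "strassen_preorder Q" by simp_all
  interpret Q: strassen_preorder Q by (rule Q)
  have mem: "(a, b) \<in> Q" if "\<And>c s. (c + 1 + s * b, c + s * a) \<notin> Q" for a b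
  proof -
    have "adjoin Q a b \<in> ?A"
      using Q.strassen_preorder_adjoin[OF that] order.trans[OF RQ Q.subset_adjoin] by simp
    then have "adjoin Q a b = Q" using max Q.subset_adjoin by simp
    then show ?thesis using Q.mem_adjoin[of a b] by simp
  qed
  have "(a, b) \<in> Q \<or> (b, a) \<in> Q" for a b
  proof (cases "\<exists>c s. (c + 1 + s * b, c + s * a) \<in> Q")
    case True
    then have "(c + 1 + s * a, c + s * b) \<notin> Q" for c s using Q.degenerate_antisym by blast
    then show ?thesis using mem by blast
  qed (use mem in blast)
  with RQ Q show ?thesis by (rule that)
qed

end

section \<open>Real values in a total preorder\<close>

text \<open>Floors at scale \<open>n\<close> determine values up to an error of order
  \<open>1 / n\<close>; this turns such estimates into exact equations.\<close>

lemma real_eq_if_close: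
  fixes u v :: real
  assumes "\<And>n. 0 < n \<Longrightarrow> \<bar>u - v\<bar> \<le> K / real n"
  shows "u = v"
proof (rule ccontr)
  assume "u \<noteq> v"
  then have "0 < \<bar>u - v\<bar>" by simp
  then obtain n where "K < real n * \<bar>u - v\<bar>" using reals_Archimedean3 by blast
  then have "K < real (Suc n) * \<bar>u - v\<bar>" using \<open>0 < \<bar>u - v\<bar>\<close> by (simp add: algebra_simps)
  with assms[of "Suc n"] show False by (simp add: field_simps)
qed

locale total_strassen_preorder = strassen_preorder R for R :: "'a::comm_semiring_1 rel" +
  assumes total: "(a, b) \<in> R \<or> (b, a) \<in> R"
begin

text \<open>The upper cut of \<open>x\<close> among the fractions; it is nonempty by
  \<open>upper\<close> and bounded below by 0, so the infimum is meaningful.\<close>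

definition slope :: "'a \<Rightarrow> real" where
  "slope x = Inf {real p / real q | p q. 0 < q \<and> of_nat q * x \<preceq> of_nat p}"

lemma slope_le:
  assumes "0 < q" "of_nat q * x \<preceq> of_nat p"
  shows "slope x \<le> real p / real q"
  unfolding slope_def using assms
  by (intro cInf_lower bdd_belowI[of _ 0]) auto

lemma le_slope:
  assumes "0 < q" "of_nat p \<preceq> of_nat q * x"
  shows "real p / real q \<le> slope x"
  unfolding slope_def
proof (rule cInf_greatest)
  obtain n where "x \<preceq> of_nat n" using upper by blast
  then have "of_nat 1 * x \<preceq> of_nat n" by simp
  then have "real n / real 1 \<in> {real p / real q | p q. 0 < q \<and> of_nat q * x \<preceq> of_nat p}"
    by blast
  then show "{real p / real q | p q. 0 < q \<and> of_nat q * x \<preceq> of_nat p} \<noteq> {}" by blast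
  fix r assume "r \<in> {real p / real q | p q. 0 < q \<and> of_nat q * x \<preceq> of_nat p}"
  then obtain p' q' where r: "r = real p' / real q'" "0 < q'" "of_nat q' * x \<preceq> of_nat p'" by blast
  \<comment> \<open>Cross-multiplication: a fraction below \<open>x\<close> and one above it become
    comparable naturals, where the preorder agrees with the usual order.\<close>
  have "of_nat (q' * p) \<preceq> of_nat q' * (of_nat q * x)"
    using mult_left[OF assms(2), of "of_nat q'"] by simp
  also have "of_nat q' * (of_nat q * x) = of_nat q * (of_nat q' * x)" by (simp add: algebra_simps)
  finally have "of_nat (q' * p) \<preceq> of_nat (q * p')"
    using mult_left[OF r(3), of "of_nat q"] trans by (metis of_nat_mult)
  then have "q' * p \<le> q * p'" by (simp only: of_nat_le_iff)
  then have "real q' * real p \<le> real q * real p'" by (metis of_nat_mult Nat.of_nat_le_iff)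
  then show "real p / real q \<le> r" unfolding r(1) using r(2) assms(1) by (simp add: field_simps)
qed

text \<open>A greatest natural below \<open>n * x\<close> exists by \<open>upper\<close>; totality
  turns the failure of its successor into the upper estimate.\<close>

lemma ex_floor: "\<exists>p. of_nat p \<preceq> of_nat n * x \<and> of_nat n * x \<preceq> of_nat (Suc p)"
proof -
  obtain m where m: "of_nat n * x \<preceq> of_nat m" using upper by blast
  let ?P = "\<lambda>p. of_nat p \<preceq> of_nat n * x"
  have 0: "?P 0" using zero_le by simp
  have b: "p \<le> m" if "?P p" for p using trans[OF that m] of_nat_le_iff by blast
  define p where "p = Greatest ?P"
  have "?P p" unfolding p_def by (rule GreatestI_nat[of ?P, OF 0]) (use b in blast)
  moreover have "\<not> ?P (Suc p)"
    using Greatest_le_nat[of ?P "Suc p" m] b unfolding p_def by fastforce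
  ultimately show ?thesis using total by blast
qed

text \<open>A gap in the wrong direction would exceed some \<open>1 / Suc n\<close>, but the floor
  \<open>p\<close> of \<open>y\<close> at scale \<open>Suc n\<close> bounds the slope of
  \<open>y\<close> below by \<open>p / Suc n\<close> and that of \<open>x\<close> above by
  \<open>Suc p / Suc n\<close>.\<close>

lemma slope_mono:
  assumes "x \<preceq> y"
  shows "slope x \<le> slope y"
proof (rule ccontr)
  assume "\<not> slope x \<le> slope y"
  then obtain n where n: "inverse (real (Suc n)) < slope x - slope y"
    using reals_Archimedean[of "slope x - slope y"] by auto
  obtain p where p: "of_nat p \<preceq> of_nat (Suc n) * y" "of_nat (Suc n) * y \<preceq> of_nat (Suc p)"
    using ex_floor by blast
  have "slope x \<le> real (Suc p) / real (Suc n)"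
    by (rule slope_le) (use trans[OF mult_left[OF assms] p(2)] in auto)
  moreover have "real p / real (Suc n) \<le> slope y"
    by (rule le_slope) (use p in auto)
  ultimately have "slope x - slope y \<le> real (Suc p) / real (Suc n) - real p / real (Suc n)" by simp
  also have "\<dots> = inverse (real (Suc n))" by (simp add: field_simps)
  finally show False using n by simp
qed

lemma slope_of_nat: "slope (of_nat n) = real n"
  using slope_le[of 1 "of_nat n" n] le_slope[of 1 n "of_nat n"] refl[of "of_nat n"] by simp

lemma slope_nonneg: "0 \<le> slope x"
  using slope_mono[OF zero_le[of x]] slope_of_nat[of 0] by simp

lemma slope_add: "slope (x + y) = slope x + slope y"
proof (rule real_eq_if_close)
  fix n :: nat assume n: "0 < n"
  obtain p where p: "of_nat p \<preceq> of_nat n * x" "of_nat n * x \<preceq> of_nat (Suc p)"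
    using ex_floor by blast
  obtain q where q: "of_nat q \<preceq> of_nat n * y" "of_nat n * y \<preceq> of_nat (Suc q)"
    using ex_floor by blast
  have "of_nat (p + q) \<preceq> of_nat n * (x + y)" "of_nat n * (x + y) \<preceq> of_nat (Suc p + Suc q)"
    unfolding distrib_left of_nat_add by (intro add_mono p q)+
  then have "real (p + q) / real n \<le> slope (x + y)" "slope (x + y) \<le> real (Suc p + Suc q) / real n"
    by (blast intro: le_slope[OF n] slope_le[OF n])+
  moreover define u v e where "u = real p / real n" and "v = real q / real n" and "e = 1 / real n"
  moreover have "u \<le> slope x" "slope x \<le> u + e" "v \<le> slope y" "slope y \<le> v + e"
    using le_slope[OF n p(1)] slope_le[OF n p(2)] le_slope[OF n q(1)] slope_le[OF n q(2)]
    by (simp_all add: u_def v_def e_def add_divide_distrib add.commute)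
  ultimately have "\<bar>slope (x + y) - (slope x + slope y)\<bar> \<le> 2 * e"
    by (simp add: add_divide_distrib)
  then show "\<bar>slope (x + y) - (slope x + slope y)\<bar> \<le> 2 / real n" by (simp add: e_def)
qed

lemma slope_mult: "slope (x * y) = slope x * slope y"
proof (rule real_eq_if_close)
  fix n :: nat assume n: "0 < n"
  obtain p where p: "of_nat p \<preceq> of_nat n * x" "of_nat n * x \<preceq> of_nat (Suc p)"
    using ex_floor by blast
  obtain q where q: "of_nat q \<preceq> of_nat n * y" "of_nat n * y \<preceq> of_nat (Suc q)"
    using ex_floor by blast
  have eq: "of_nat (n * n) * (x * y) = (of_nat n * x) * (of_nat n * y)"
    by (simp add: algebra_simps)
  have lu: "of_nat (p * q) \<preceq> of_nat (n * n) * (x * y)"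
    "of_nat (n * n) * (x * y) \<preceq> of_nat (Suc p * Suc q)"
    unfolding eq unfolding of_nat_mult by (intro mult_mono p q)+
  have xy: "real (p * q) / real (n * n) \<le> slope (x * y)"
    "slope (x * y) \<le> real (Suc p * Suc q) / real (n * n)"
    using n by (blast intro: le_slope[OF _ lu(1)] slope_le[OF _ lu(2)] mult_pos_pos)+
  \<comment> \<open>\<open>u\<close> and \<open>v\<close> are the floors at step \<open>e\<close>.
    Both sides of the claim lie between \<open>u * v\<close> and \<open>(u + e) * (v + e)\<close>,
    an interval of length \<open>(u + v + e) * e\<close>.\<close>
  define u v e where "u = real p / real n" and "v = real q / real n" and "e = 1 / real n"
  have ux: "u \<le> slope x" "slope x \<le> u + e" and vy: "v \<le> slope y" "slope y \<le> v + e"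
    using le_slope[OF n p(1)] slope_le[OF n p(2)] le_slope[OF n q(1)] slope_le[OF n q(2)]
    by (simp_all add: u_def v_def e_def add_divide_distrib add.commute)
  have nn: "0 \<le> u" "0 \<le> v" "0 \<le> e" "e \<le> 1" using n by (simp_all add: u_def v_def e_def)
  have "real (p * q) / real (n * n) = u * v"
    "real (Suc p * Suc q) / real (n * n) = (u + e) * (v + e)"
    using n by (simp_all add: u_def v_def e_def field_simps)
  with xy have "u * v \<le> slope (x * y)" "slope (x * y) \<le> (u + e) * (v + e)" by simp_all
  moreover have "u * v \<le> slope x * slope y" "slope x * slope y \<le> (u + e) * (v + e)"
    using ux vy nn slope_nonneg by (intro Rings.mult_mono; linarith)+
  ultimately have "\<bar>slope (x * y) - slope x * slope y\<bar> \<le> (u + e) * (v + e) - u * v" by linarith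
  also have "\<dots> = (u + v + e) * e" by (simp add: algebra_simps)
  also have "\<dots> \<le> (slope x + slope y + 1) * e"
    using ux vy nn by (intro mult_right_mono) auto
  finally show "\<bar>slope (x * y) - slope x * slope y\<bar> \<le> (slope x + slope y + 1) / real n"
    by (simp add: e_def)
qed

end

text \<open>The points of the real spectrum; \<open>hom_of_nat\<close> includes preservation of 0
  and 1.\<close>

locale monotone_hom = strassen_preorder R for R :: "'a::comm_semiring_1 rel" +
  fixes \<phi> :: "'a \<Rightarrow> real"
  assumes hom_of_nat: "\<phi> (of_nat n) = real n"
    and hom_add: "\<phi> (a + b) = \<phi> a + \<phi> b"
    and hom_mult: "\<phi> (a * b) = \<phi> a * \<phi> b"
    and hom_mono: "(a, b) \<in> R \<Longrightarrow> \<phi> a \<le> \<phi> b"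
    and hom_nonneg: "0 \<le> \<phi> a"

section \<open>Separation by monotone homomorphisms\<close>

context strassen_preorder
begin

lemma ex_monotone_hom: "\<exists>\<phi>. monotone_hom R \<phi>"
proof -
  obtain Q where RQ: "R \<subseteq> Q" and Q: "strassen_preorder Q"
    and tot: "\<And>a b. (a, b) \<in> Q \<or> (b, a) \<in> Q" by (rule ex_total_extension) blast
  interpret Q: total_strassen_preorder Q
    using Q tot by (simp add: total_strassen_preorder_def total_strassen_preorder_axioms_def)
  have "monotone_hom R Q.slope"
    using RQ by unfold_locales
      (auto simp: Q.slope_of_nat Q.slope_add Q.slope_mult Q.slope_nonneg intro: Q.slope_mono)
  then show ?thesis by blast
qed

text \<open>Adjoin \<open>a\<close> below \<open>b\<close>. If nothing collapses, a monotone
  homomorphism for the larger preorder is also one for \<open>R\<close> and respects the new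
  relation; otherwise \<open>c\<close> and \<open>s\<close> witness the collapse.\<close>

lemma separation:
  obtains \<phi> where "monotone_hom R \<phi>" "\<phi> a \<le> \<phi> b"
  | c s where "c + 1 + s * b \<preceq> c + s * a"
proof (cases "\<exists>c s. c + 1 + s * b \<preceq> c + s * a")
  case False
  then interpret Q: strassen_preorder "adjoin R a b" by (intro strassen_preorder_adjoin) blast
  obtain \<phi> where "monotone_hom (adjoin R a b) \<phi>" using Q.ex_monotone_hom by blast
  then interpret \<phi>: monotone_hom "adjoin R a b" \<phi> .
  have "monotone_hom R \<phi>"
    by unfold_locales (simp_all add: \<phi>.hom_of_nat \<phi>.hom_add \<phi>.hom_mult \<phi>.hom_nonneg
      \<phi>.hom_mono[OF subsetD[OF subset_adjoin]])
  then show ?thesis using that(1) \<phi>.hom_mono[OF mem_adjoin] by blast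
qed (use that in blast)

section \<open>Power bounds from a collapse\<close>

text \<open>The summand \<open>c\<close> acts as a catalyst: it is returned after every replacement
  of \<open>x\<close> by \<open>y\<close>, so one copy serves all \<open>k\<close> of them.\<close>

lemma mult_le_of_add_le:
  assumes "x + c \<preceq> y + c"
  shows "of_nat k * x + c \<preceq> of_nat k * y + c"
proof (induction k)
  case (Suc k)
  have "x + (of_nat k * x + c) \<preceq> x + (of_nat k * y + c)" by (rule add_mono[OF refl Suc])
  moreover have "(x + c) + of_nat k * y \<preceq> (y + c) + of_nat k * y" by (rule add_right[OF assms])
  ultimately show ?case
    using trans[of "x + (of_nat k * x + c)" "x + (of_nat k * y + c)" "(y + c) + of_nat k * y"]
    by (simp add: algebra_simps)
qed (simp add: refl)

text \<open>Replacing a factor \<open>a\<close> by \<open>b\<close> costs the ratio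
  \<open>(k + d) / k\<close>, up to one constant \<open>C\<close> in total. The free parameter
  \<open>k\<close> makes this ratio as close to 1 as desired.\<close>

lemma ex_power_bound:
  assumes "c + 1 + s * a \<preceq> c + s * b"
  shows "\<exists>d C. \<forall>k N. of_nat (k ^ N) * a ^ N \<preceq> of_nat (C * (k + d) ^ N) * b ^ N"
proof -
  have y: "s * b \<noteq> 0"
  proof
    assume "s * b = 0"
    then have "(c + 1) + s * a \<preceq> c" using assms by simp
    then show False using not_succ_le trans le_add by blast
  qed
  obtain n where n: "c \<preceq> of_nat n" using upper by blast
  obtain r where r: "1 \<preceq> of_nat r * (s * b)" using lower[OF y] by blast
  \<comment> \<open>Apply the inequality \<open>k\<close> times with catalyst \<open>c\<close>, then
    absorb the leftover \<open>c\<close> into \<open>n * r\<close> copies of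
    \<open>s * b\<close>.\<close>
  have main: "of_nat k * (s * a) \<preceq> of_nat (k + n * r) * (s * b)" for k
  proof -
    have "s * a + c \<preceq> (s * a + c) + 1" by (rule le_add)
    then have "s * a + c \<preceq> c + 1 + s * a" by (simp add: algebra_simps)
    then have "s * a + c \<preceq> c + s * b" using assms by (rule trans)
    then have "s * a + c \<preceq> s * b + c" by (simp add: add.commute)
    then have "of_nat k * (s * a) + c \<preceq> of_nat k * (s * b) + c" by (rule mult_le_of_add_le)
    then have 1: "of_nat k * (s * a) \<preceq> of_nat k * (s * b) + c" using le_add trans by blast
    have "c \<preceq> of_nat n * (of_nat r * (s * b))"
      using trans[OF n] mult_left[OF r, of "of_nat n"] by simp
    then have "of_nat k * (s * b) + c \<preceq> of_nat k * (s * b) + of_nat n * (of_nat r * (s * b))"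
      by (rule add_mono[OF refl])
    also have "of_nat k * (s * b) + of_nat n * (of_nat r * (s * b)) = of_nat (k + n * r) * (s * b)"
      by (simp add: algebra_simps)
    finally show ?thesis by (rule trans[OF 1])
  qed
  \<comment> \<open>Here \<open>s\<close> is a multiplicative catalyst: each step trades one
    \<open>a\<close> for one \<open>b\<close> in its presence.\<close>
  have pow: "of_nat (k ^ N) * (s * a ^ N) \<preceq> of_nat ((k + n * r) ^ N) * (s * b ^ N)" for k N
  proof (induction N)
    case (Suc N)
    have "of_nat (k ^ Suc N) * (s * a ^ Suc N) = of_nat k * a * (of_nat (k ^ N) * (s * a ^ N))"
      by (simp add: algebra_simps)
    also have "\<dots> \<preceq> of_nat k * a * (of_nat ((k + n * r) ^ N) * (s * b ^ N))"
      by (rule mult_left[OF Suc])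
    also have "of_nat k * a * (of_nat ((k + n * r) ^ N) * (s * b ^ N))
        = of_nat ((k + n * r) ^ N) * b ^ N * (of_nat k * (s * a))"
      by (simp only: mult_ac)
    finally have 1: "of_nat (k ^ Suc N) * (s * a ^ Suc N)
        \<preceq> of_nat ((k + n * r) ^ N) * b ^ N * (of_nat k * (s * a))" .
    have "of_nat ((k + n * r) ^ Suc N) * (s * b ^ Suc N)
       = of_nat ((k + n * r) ^ N) * b ^ N * (of_nat (k + n * r) * (s * b))"
      by (simp only: power_Suc of_nat_mult mult_ac)
    with trans[OF 1 mult_left[OF main]] show ?case by simp
  qed (simp add: refl)
  obtain m where m: "s \<preceq> of_nat m" using upper by blast
  obtain t where t: "1 \<preceq> of_nat t * s" using lower[of s] y by fastforce
  \<comment> \<open>\<open>s\<close> is inserted at the cost \<open>t\<close> and removed at the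
    cost \<open>m\<close>, which gives the constant \<open>t * m\<close>.\<close>
  have "of_nat (k ^ N) * a ^ N \<preceq> of_nat ((t * m) * (k + n * r) ^ N) * b ^ N" for k N
  proof -
    have "of_nat (k ^ N) * a ^ N \<preceq> (of_nat t * s) * (of_nat (k ^ N) * a ^ N)"
      using mult_right[OF t] by simp
    also have "(of_nat t * s) * (of_nat (k ^ N) * a ^ N) = of_nat t * (of_nat (k ^ N) * (s * a ^ N))"
      by (simp only: mult_ac)
    finally have 1: "of_nat (k ^ N) * a ^ N \<preceq> of_nat t * (of_nat ((k + n * r) ^ N) * (s * b ^ N))"
      using trans mult_left[OF pow] by blast
    have "of_nat t * (of_nat ((k + n * r) ^ N) * (s * b ^ N))
        = s * (of_nat t * of_nat ((k + n * r) ^ N) * b ^ N)"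
      by (simp only: mult_ac)
    also have "\<dots> \<preceq> of_nat m * (of_nat t * of_nat ((k + n * r) ^ N) * b ^ N)"
      by (rule mult_right[OF m])
    finally show ?thesis using trans[OF 1] by (simp add: mult_ac)
  qed
  then show ?thesis by blast
qed

end

text \<open>\<open>(1 + 1 / N) ^ N\<close> is at most \<open>exp 1\<close>, hence at most 3; an
  integer constant keeps the later estimates in the naturals.\<close>

lemma Suc_power_le: "Suc N ^ N \<le> 3 * N ^ N"
proof (cases "N = 0")
  case False
  have "(1 + 1 / real N) ^ N \<le> exp (1 / real N) ^ N"
    using exp_ge_add_one_self[of "1 / real N"] by (intro Power.power_mono) auto
  also have "\<dots> = exp 1" using False by (simp flip: exp_of_nat_mult)
  also have "\<dots> \<le> 3" by (rule exp_le)
  finally have "(1 + 1 / real N) ^ N * real N ^ N \<le> 3 * real N ^ N" by (intro mult_right_mono) auto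
  also have "(1 + 1 / real N) ^ N * real N ^ N = real (Suc N) ^ N"
    using False by (simp add: field_simps flip: power_mult_distrib)
  finally have "real (Suc N ^ N) \<le> real (3 * N ^ N)" by simp
  then show ?thesis by (simp only: of_nat_le_iff)
qed simp

context strassen_preorder
begin

text \<open>The multiplicative error is \<open>D ^ M\<close> up to a factor independent of \<open>M\<close>, so its growth rate
  relative to the exponent \<open>N * M\<close> is arbitrarily small.\<close>

lemma asymptotic_bound:
  assumes "c + 1 + s * a \<preceq> c + s * b"
  shows "\<exists>D. \<forall>N. \<exists>q. \<forall>M. a ^ (N * M) \<preceq> of_nat (q * D ^ M) * b ^ (N * M)"
proof -
  obtain d' C where dC': "\<And>k N. of_nat (k ^ N) * a ^ N \<preceq> of_nat (C * (k + d') ^ N) * b ^ N"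
    using ex_power_bound[OF assms] by blast
  \<comment> \<open>Making \<open>d\<close> positive ensures that \<open>q\<close> below is nonzero
    for \<open>0 < N\<close>.\<close>
  define d where "d = Suc d'"
  have dC: "of_nat (k ^ N) * a ^ N \<preceq> of_nat (C * (k + d) ^ N) * b ^ N" for k N
  proof -
    have "C * (k + d') ^ N \<le> C * (k + d) ^ N" by (auto simp: d_def intro: Power.power_mono)
    then have "of_nat (C * (k + d') ^ N) * b ^ N \<preceq> of_nat (C * (k + d) ^ N) * b ^ N"
      by (intro mult_right of_nat_mono)
    with dC' show ?thesis using trans by blast
  qed
  \<comment> \<open>With \<open>k = d * N\<close>, a block of \<open>N\<close> factors costs the
    ratio \<open>C * (1 + 1 / N) ^ N\<close>, at most \<open>C * 3\<close> whatever \<open>N\<close>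
    is.\<close>
  define D where "D = C * 3"
  have "\<exists>q. \<forall>M. a ^ (N * M) \<preceq> of_nat (q * D ^ M) * b ^ (N * M)" for N
  proof (cases "N = 0")
    case True
    have "1 \<le> D"
      using dC[of 1 0] of_nat_le_iff[of 1 C] by (simp add: D_def)
    then have "a ^ (N * M) \<preceq> of_nat (1 * D ^ M) * b ^ (N * M)" for M
      using of_nat_mono[of 1 "D ^ M"] True by simp
    then show ?thesis by blast
  next
    case False
    define q where "q = (d * N) ^ N"
    have "0 < q" using False by (simp add: q_def d_def)
    have "C * (d * N + d) ^ N = C * d ^ N * Suc N ^ N"
      by (simp add: algebra_simps flip: power_mult_distrib)
    also have "\<dots> \<le> C * d ^ N * (3 * N ^ N)" by (intro mult_left_mono Suc_power_le) simp
    also have "\<dots> = q * D" by (simp add: q_def D_def power_mult_distrib)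
    finally have "of_nat (C * (d * N + d) ^ N) * b ^ N \<preceq> of_nat (q * D) * b ^ N"
      by (intro mult_right of_nat_mono)
    with dC[of "d * N" N] have q: "of_nat q * a ^ N \<preceq> of_nat (q * D) * b ^ N"
      unfolding q_def using trans by blast
    \<comment> \<open>No cancellation of \<open>q\<close> is available, so it is carried on the left
      through all \<open>M\<close> blocks and enters the bound only once.\<close>
    have *: "of_nat q * a ^ (N * M) \<preceq> of_nat (q * D ^ M) * b ^ (N * M)" for M
    proof (induction M)
      case (Suc M)
      have "of_nat q * a ^ (N * Suc M) = a ^ N * (of_nat q * a ^ (N * M))"
        by (simp add: power_add mult_ac)
      also have "\<dots> \<preceq> a ^ N * (of_nat (q * D ^ M) * b ^ (N * M))"
        by (rule mult_left[OF Suc])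
      also have "a ^ N * (of_nat (q * D ^ M) * b ^ (N * M))
          = of_nat (D ^ M) * b ^ (N * M) * (of_nat q * a ^ N)"
        by (simp add: mult_ac)
      finally have 1: "of_nat q * a ^ (N * Suc M) \<preceq> of_nat (D ^ M) * b ^ (N * M) * (of_nat q * a ^ N)" .
      show ?case using trans[OF 1 mult_left[OF q]] by (simp add: power_add mult_ac)
    qed (simp add: refl)
    have "a ^ (N * M) \<preceq> of_nat q * a ^ (N * M)" for M
      using mult_right[OF of_nat_mono[of 1 q], of "a ^ (N * M)"] \<open>0 < q\<close> by simp
    then show ?thesis using * trans by blast
  qed
  then show ?thesis by blast
qed

end

section \<open>The rate formula\<close>

context monotone_hom
begin

lemma hom_power: "\<phi> (a ^ n) = \<phi> a ^ n"
  using hom_of_nat[of 1] by (induction n) (simp_all add: hom_mult)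

lemma hom_ge_2: "(2, a) \<in> R \<Longrightarrow> 2 \<le> \<phi> a"
  using hom_mono[of 2 a] hom_of_nat[of 2] by simp

end

context strassen_preorder
begin

definition rate :: "'a \<Rightarrow> 'a \<Rightarrow> ereal" where
  "rate g h = Sup {ereal (real m / real n) | m n. 0 < m \<and> 0 < n \<and> h ^ m \<preceq> g ^ n}"

lemma le_rate: "0 < m \<Longrightarrow> 0 < n \<Longrightarrow> h ^ m \<preceq> g ^ n \<Longrightarrow> ereal (real m / real n) \<le> rate g h"
  unfolding rate_def by (rule Sup_upper) blast

lemma two_power_le: "2 \<preceq> g \<Longrightarrow> of_nat (2 ^ j) \<preceq> g ^ j"
  using power_mono[of 2 g j] by simp

text \<open>A natural bound \<open>n\<close> on \<open>h\<close> is below \<open>2 ^ Suc n\<close>,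
  hence below \<open>g ^ Suc n\<close>. The exponent \<open>Suc n\<close> keeps the denominator
  positive also for \<open>n = 0\<close>.\<close>

lemma rate_pos:
  assumes "2 \<preceq> g"
  shows "0 < rate g h"
proof -
  obtain n where n: "h \<preceq> of_nat n" using upper by blast
  have "n \<le> 2 ^ Suc n" using less_exp[of "Suc n"] by linarith
  then have "of_nat n \<preceq> of_nat (2 ^ Suc n)" by (rule of_nat_mono)
  then have "h ^ 1 \<preceq> g ^ Suc n" using n trans two_power_le[OF assms] by (metis power_one_right)
  then have "ereal (real 1 / real (Suc n)) \<le> rate g h" by (intro le_rate) auto
  moreover have "0 < ereal (real 1 / real (Suc n))" by simp
  ultimately show ?thesis by (rule less_le_trans[rotated])
qed

text \<open>The error \<open>q * D ^ M\<close> from \<open>asymptotic_bound\<close> is paid for by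
  \<open>M + D * M\<close> extra factors \<open>g\<close>. The common \<open>M\<close> cancels, and
  the fractions \<open>m * N / (1 + D + n * N)\<close> tend to \<open>m / n\<close>.\<close>

lemma rate_ge_of_degenerate:
  assumes g: "2 \<preceq> g" and m: "0 < m"
    and deg: "c + 1 + s * h ^ m \<preceq> c + s * g ^ n"
  shows "ereal (real m / real n) \<le> rate g h"
proof -
  obtain D where D: "\<And>N. \<exists>q. \<forall>M. (h ^ m) ^ (N * M) \<preceq> of_nat (q * D ^ M) * (g ^ n) ^ (N * M)"
    using asymptotic_bound[OF deg] by blast
  have "1 \<preceq> g" using of_nat_mono[of 1 2] g trans by simp
  have bound: "ereal (real (m * N) / real (1 + D + n * N)) \<le> rate g h" if N: "0 < N" for N
  proof -
    obtain q where q: "\<And>M. (h ^ m) ^ (N * M) \<preceq> of_nat (q * D ^ M) * (g ^ n) ^ (N * M)"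
      using D by blast
    \<comment> \<open>\<open>M\<close> exceeds \<open>q\<close>, so \<open>2 ^ q\<close> is at most
      \<open>2 ^ M\<close>; being positive, \<open>M\<close> can be cancelled from the
      fraction.\<close>
    define M where "M = Suc q"
    have "q * D ^ M \<le> 2 ^ q * (2 ^ D) ^ M"
      by (intro mult_le_mono Power.power_mono less_imp_le[OF less_exp]) simp
    also have "\<dots> = 2 ^ (q + D * M)" by (simp add: power_add power_mult)
    also have "\<dots> \<le> 2 ^ (M + D * M)" by (intro power_increasing) (auto simp: M_def)
    finally have "of_nat (q * D ^ M) \<preceq> g ^ (M + D * M)"
      using of_nat_mono trans two_power_le[OF g] by blast
    then have "(h ^ m) ^ (N * M) \<preceq> g ^ (M + D * M) * (g ^ n) ^ (N * M)"
      using q trans mult_right by blast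
    then have "h ^ (m * N * M) \<preceq> g ^ ((1 + D + n * N) * M)"
      by (simp add: power_mult power_add algebra_simps flip: power_mult)
    then have "ereal (real (m * N * M) / real ((1 + D + n * N) * M)) \<le> rate g h"
      using m N by (intro le_rate) (auto simp: M_def)
    moreover have "real (m * N * M) / real ((1 + D + n * N) * M) = real (m * N) / real (1 + D + n * N)"
      unfolding of_nat_mult[of _ M] by (rule mult_divide_mult_cancel_right) (simp add: M_def)
    ultimately show ?thesis by simp
  qed
  show ?thesis
  proof (cases "n = 0")
    \<comment> \<open>Division by zero makes \<open>m / n\<close> equal to 0 here.\<close>
    case True
    then show ?thesis using rate_pos[OF g] by (simp add: less_imp_le zero_ereal_def)
  next
    case False
    have "(\<lambda>N. real (m * N) / real (1 + D + n * N)) \<longlonglongrightarrow> real m / real n"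
      using False by real_asymp (simp add: divide_inverse)
    then have "(\<lambda>N. ereal (real (m * N) / real (1 + D + n * N))) \<longlonglongrightarrow> ereal (real m / real n)"
      by (rule tendsto_ereal)
    then show ?thesis
    proof (rule LIMSEQ_le_const2, intro exI allI impI)
      fix N :: nat assume "1 \<le> N"
      then show "ereal (real (m * N) / real (1 + D + n * N)) \<le> rate g h" by (intro bound) simp
    qed
  qed
qed

text \<open>Upper bound: apply \<open>\<phi>\<close> and take logarithms; the denominators are
  positive because \<open>2\<close> lies below \<open>h\<close>. Lower bound: for a rational
  \<open>m / n\<close> strictly between the two sides, \<open>separation\<close> yields either a
  homomorphism contradicting the infimum or a collapse contradicting the rate.\<close>

lemma rate_eq_INF:
  assumes g: "2 \<preceq> g" and h: "2 \<preceq> h"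
  shows "rate g h = (INF \<phi>\<in>{\<phi>. monotone_hom R \<phi>}. ereal (ln (\<phi> g)) / ereal (ln (\<phi> h)))"
    (is "_ = ?I")
proof (rule antisym)
  show "rate g h \<le> ?I"
  proof (rule INF_greatest)
    fix \<phi> assume "\<phi> \<in> {\<phi>. monotone_hom R \<phi>}"
    then interpret monotone_hom R \<phi> by simp
    note g2 = hom_ge_2[OF g] and h2 = hom_ge_2[OF h]
    have pos: "0 < ln (\<phi> h)" using h2 by simp
    have "ereal (real m / real n) \<le> ereal (ln (\<phi> g)) / ereal (ln (\<phi> h))"
      if mn: "0 < m" "0 < n" "h ^ m \<preceq> g ^ n" for m n
    proof -
      have "\<phi> h ^ m \<le> \<phi> g ^ n" using hom_mono[OF mn(3)] by (simp add: hom_power)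
      moreover have "0 < \<phi> h ^ m" "0 < \<phi> g ^ n" using g2 h2 by (intro zero_less_power; linarith)+
      ultimately have "ln (\<phi> h ^ m) \<le> ln (\<phi> g ^ n)" by (simp only: ln_le_cancel_iff)
      moreover have "ln (\<phi> h ^ m) = real m * ln (\<phi> h)" by (rule ln_realpow)
      moreover have "ln (\<phi> g ^ n) = real n * ln (\<phi> g)" by (rule ln_realpow)
      ultimately have "real m * ln (\<phi> h) \<le> real n * ln (\<phi> g)" by (simp only:)
      then have "real m / real n \<le> ln (\<phi> g) / ln (\<phi> h)"
        using pos mn by (simp add: field_simps)
      then show ?thesis using pos by simp
    qed
    then show "rate g h \<le> ereal (ln (\<phi> g)) / ereal (ln (\<phi> h))"
      unfolding rate_def by (intro Sup_least) (elim CollectE exE conjE, simp only:)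
  qed
  show "?I \<le> rate g h"
  proof (rule ccontr)
    assume "\<not> ?I \<le> rate g h"
    then have "rate g h < ?I" by simp
    then obtain r :: rat where r: "rate g h < ereal (of_rat r)" "ereal (of_rat r) < ?I"
      using ereal_dense3 by blast
    have "0 < r" using less_trans[OF rate_pos[OF g] r(1)] by simp
    obtain m n :: nat where mn: "0 < m" "0 < n" and req: "real_of_rat r = real m / real n"
    proof -
      obtain m n :: nat where "n \<noteq> 0" "\<bar>real_of_rat r\<bar> = real m / real n"
        by (rule Rats_abs_nat_div_natE[of "real_of_rat r"]) auto
      with \<open>0 < r\<close> show ?thesis by (intro that[of m n]) (auto intro: gr0I)
    qed
    from separation[of "g ^ n" "h ^ m"] show False
    proof cases
      case (1 \<phi>)
      then interpret monotone_hom R \<phi> by simp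
      note g2 = hom_ge_2[OF g] and h2 = hom_ge_2[OF h]
      have pos: "0 < ln (\<phi> h)" using h2 by simp
      have "?I \<le> ereal (ln (\<phi> g)) / ereal (ln (\<phi> h))"
        using 1 by (intro INF_lower) simp
      with r(2) have "ereal (real m / real n) < ereal (ln (\<phi> g)) / ereal (ln (\<phi> h))"
        unfolding req by (rule less_le_trans)
      then have "real m / real n < ln (\<phi> g) / ln (\<phi> h)" using pos by simp
      then have "real m * ln (\<phi> h) < real n * ln (\<phi> g)" using pos mn by (simp add: field_simps)
      then have "ln (\<phi> h ^ m) < ln (\<phi> g ^ n)" using g2 h2 by (simp add: ln_realpow)
      then have "\<phi> h ^ m < \<phi> g ^ n" using g2 h2 by (subst (asm) ln_less_cancel_iff) auto
      then show False using 1(2) by (simp add: hom_power)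
    next
      case (2 c s)
      then show False using rate_ge_of_degenerate[OF g mn(1)] r(1) req by (metis not_le)
    qed
  qed
qed

text \<open>Both sides are infinite: \<open>1\<close> lies below \<open>g\<close>, so
  \<open>m / 1\<close> is admissible for every positive \<open>m\<close>, while
  \<open>ln (\<phi> 1) = 0\<close> and a positive \<open>ereal\<close> divided by 0 is
  infinite.\<close>

lemma rate_one_eq_INF:
  assumes g: "2 \<preceq> g"
  shows "rate g 1 = (INF \<phi>\<in>{\<phi>. monotone_hom R \<phi>}. ereal (ln (\<phi> g)) / ereal (ln (\<phi> 1)))"
proof -
  have "1 \<preceq> g" using of_nat_mono[of 1 2] g trans by simp
  have "rate g 1 = \<infinity>"
  proof (rule ereal_top)
    fix B
    obtain m where "B \<le> real m" using real_arch_simple by blast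
    then have "ereal B \<le> ereal (real (Suc m) / real 1)" by simp
    also have "\<dots> \<le> rate g 1" using \<open>1 \<preceq> g\<close> by (intro le_rate) simp_all
    finally show "ereal B \<le> rate g 1" .
  qed
  moreover have "ereal (ln (\<phi> g)) / ereal (ln (\<phi> 1)) = \<infinity>" if "monotone_hom R \<phi>" for \<phi>
  proof -
    interpret monotone_hom R \<phi> by (rule that)
    show ?thesis using hom_ge_2[OF g] hom_of_nat[of 1] by (simp add: divide_ereal_def)
  qed
  ultimately show ?thesis by (simp add: INF_top_conv flip: top_ereal_def)
qed

end

section \<open>Graphs up to homomorphic equivalence\<close>

lemma graph_hom_existsI:
  assumes "\<forall>v. v \<in> pverts G \<longrightarrow> f v \<in> pverts H" "\<forall>u v. (u, v) \<in> parcs G \<longrightarrow> (f u, f v) \<in> parcs H"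
  shows "graph_hom_exists G H"
  using assms unfolding graph_hom_exists_def by blast

lemma graph_hom_exists_refl: "graph_hom_exists G G"
  by (rule graph_hom_existsI[where f = id]) auto

lemma graph_hom_exists_trans:
  assumes "graph_hom_exists G H" "graph_hom_exists H K"
  shows "graph_hom_exists G K"
proof -
  obtain f g where "\<forall>v \<in> pverts G. f v \<in> pverts H" "\<forall>(u, v) \<in> parcs G. (f u, f v) \<in> parcs H"
    "\<forall>v \<in> pverts H. g v \<in> pverts K" "\<forall>(u, v) \<in> parcs H. (g u, g v) \<in> parcs K"
    using assms unfolding graph_hom_exists_def by blast
  then show ?thesis by (intro graph_hom_existsI[where f = "g \<circ> f"]) auto
qed

lemma arcs_verts: "pair_graph G \<Longrightarrow> (u, v) \<in> parcs G \<Longrightarrow> u \<in> pverts G \<and> v \<in> pverts G"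
  by (auto simp: pair_graph_iff)

lemma verts_join [simp]: "pverts (graph_join G H) = pverts G <+> pverts H"
  by (simp add: graph_join_def)

lemma arcs_join [simp]:
  "(Inl u, Inl v) \<in> parcs (graph_join G H) \<longleftrightarrow> (u, v) \<in> parcs G"
  "(Inr x, Inr y) \<in> parcs (graph_join G H) \<longleftrightarrow> (x, y) \<in> parcs H"
  "(Inl u, Inr y) \<in> parcs (graph_join G H) \<longleftrightarrow> u \<in> pverts G \<and> y \<in> pverts H"
  "(Inr x, Inl v) \<in> parcs (graph_join G H) \<longleftrightarrow> v \<in> pverts G \<and> x \<in> pverts H"
  by (auto simp: graph_join_def)

lemma verts_disj_prod [simp]: "pverts (disj_prod G H) = pverts G \<times> pverts H"
  by (simp add: disj_prod_def)

lemma arcs_disj_prod [simp]: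
  "((u, x), (v, y)) \<in> parcs (disj_prod G H) \<longleftrightarrow>
     u \<in> pverts G \<and> v \<in> pverts G \<and> x \<in> pverts H \<and> y \<in> pverts H \<and>
     ((u, v) \<in> parcs G \<or> (x, y) \<in> parcs H)"
  by (auto simp: disj_prod_def)

lemma graph_hom_exists_join_mono:
  assumes "graph_hom_exists G G'" "graph_hom_exists H H'"
  shows "graph_hom_exists (graph_join G H) (graph_join G' H')"
proof -
  obtain f g where "\<forall>v \<in> pverts G. f v \<in> pverts G'" "\<forall>(u, v) \<in> parcs G. (f u, f v) \<in> parcs G'"
    "\<forall>v \<in> pverts H. g v \<in> pverts H'" "\<forall>(u, v) \<in> parcs H. (g u, g v) \<in> parcs H'"
    using assms unfolding graph_hom_exists_def by blast
  then show ?thesis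
    by (intro graph_hom_existsI[where f = "map_sum f g"]) (auto simp: split_sum_all)
qed

lemma graph_hom_exists_disj_prod_mono:
  assumes "graph_hom_exists G G'" "graph_hom_exists H H'"
  shows "graph_hom_exists (disj_prod G H) (disj_prod G' H')"
proof -
  obtain f g where "\<forall>v \<in> pverts G. f v \<in> pverts G'" "\<forall>(u, v) \<in> parcs G. (f u, f v) \<in> parcs G'"
    "\<forall>v \<in> pverts H. g v \<in> pverts H'" "\<forall>(u, v) \<in> parcs H. (g u, g v) \<in> parcs H'"
    using assms unfolding graph_hom_exists_def by blast
  then show ?thesis
    by (intro graph_hom_existsI[where f = "map_prod f g"]) auto
qed

text \<open>A monotone invariant cannot separate such graphs. The vertex types are independent, so
  that joins and products bracketed or ordered differently can be compared.\<close>

definition hom_equiv :: "'a pair_pre_digraph \<Rightarrow> 'b pair_pre_digraph \<Rightarrow> bool" where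
  "hom_equiv G H \<longleftrightarrow> graph_hom_exists G H \<and> graph_hom_exists H G"

lemma hom_equiv_refl: "hom_equiv G G"
  by (simp add: hom_equiv_def graph_hom_exists_refl)

lemma hom_equiv_sym: "hom_equiv G H \<Longrightarrow> hom_equiv H G"
  by (simp add: hom_equiv_def)

lemma hom_equiv_trans: "hom_equiv G H \<Longrightarrow> hom_equiv H K \<Longrightarrow> hom_equiv G K"
  using graph_hom_exists_trans[of G H K] graph_hom_exists_trans[of K H G] by (simp add: hom_equiv_def)

lemma graph_hom_exists_cong:
  "hom_equiv G G' \<Longrightarrow> hom_equiv H H' \<Longrightarrow> graph_hom_exists G H \<longleftrightarrow> graph_hom_exists G' H'"
  using graph_hom_exists_trans[of G' G H] graph_hom_exists_trans[of G' H H']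
    graph_hom_exists_trans[of G G' H'] graph_hom_exists_trans[of G H' H]
  by (auto simp: hom_equiv_def)

lemma hom_equiv_join:
  "hom_equiv G G' \<Longrightarrow> hom_equiv H H' \<Longrightarrow> hom_equiv (graph_join G H) (graph_join G' H')"
  by (simp add: hom_equiv_def graph_hom_exists_join_mono)

lemma hom_equiv_disj_prod:
  "hom_equiv G G' \<Longrightarrow> hom_equiv H H' \<Longrightarrow> hom_equiv (disj_prod G H) (disj_prod G' H')"
  by (simp add: hom_equiv_def graph_hom_exists_disj_prod_mono)

lemma iso_imp_hom_equiv:
  assumes G: "pair_graph G" and H: "pair_graph H" and iso: "digraph_iso (with_proj G) (with_proj H)"
  shows "hom_equiv G H"
proof -
  obtain f where f: "bij_betw f (pverts G) (pverts H)"
    and e: "\<And>u v. u \<in> pverts G \<Longrightarrow> v \<in> pverts G \<Longrightarrow> (u, v) \<in> parcs G \<longleftrightarrow> (f u, f v) \<in> parcs H"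
    using iso digraph_iso_pair_iff[OF pair_graph_wf[OF G] pair_graph_wf[OF H]] by blast
  let ?g = "the_inv_into (pverts G) f"
  have g: "?g y \<in> pverts G" "f (?g y) = y" if "y \<in> pverts H" for y
    using that f bij_betwE[OF bij_betw_the_inv_into[OF f]]
    by (simp_all add: f_the_inv_into_f_bij_betw)
  have "graph_hom_exists G H"
    using e bij_betwE[OF f] arcs_verts[OF G] by (intro graph_hom_existsI[where f = f]) blast+
  moreover have "graph_hom_exists H G"
  proof (rule graph_hom_existsI[where f = ?g])
    show "\<forall>v. v \<in> pverts H \<longrightarrow> ?g v \<in> pverts G" using g by blast
    show "\<forall>u v. (u, v) \<in> parcs H \<longrightarrow> (?g u, ?g v) \<in> parcs G"
      using e g arcs_verts[OF H] by metis
  qed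
  ultimately show ?thesis by (simp add: hom_equiv_def)
qed

lemma hom_equiv_nat_copy: "pair_graph G \<Longrightarrow> hom_equiv (nat_copy G) G"
  by (intro hom_equiv_sym[OF iso_imp_hom_equiv] nat_copy)

section \<open>Cliques and their homomorphisms\<close>

definition clique :: "nat \<Rightarrow> nat pair_pre_digraph" where
  "clique n = \<lparr>pverts = {..<n}, parcs = {(i, j). i < n \<and> j < n \<and> i \<noteq> j}\<rparr>"

lemma verts_clique [simp]: "pverts (clique n) = {..<n}"
  and arcs_clique [simp]: "(i, j) \<in> parcs (clique n) \<longleftrightarrow> i < n \<and> j < n \<and> i \<noteq> j"
  by (simp_all add: clique_def)

lemma pair_graph_clique [simp]: "pair_graph (clique n)"
  by (auto simp: pair_graph_iff clique_def sym_def)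

lemma hom_equiv_clique_Suc: "hom_equiv (clique (Suc n)) (graph_join (clique n) (clique 1))"
  unfolding hom_equiv_def
proof
  show "graph_hom_exists (clique (Suc n)) (graph_join (clique n) (clique 1))"
    by (rule graph_hom_existsI[where f = "\<lambda>i. if i < n then Inl i else Inr 0"])
      (auto simp: less_Suc_eq)
  show "graph_hom_exists (graph_join (clique n) (clique 1)) (clique (Suc n))"
    by (rule graph_hom_existsI[where f = "case_sum id (\<lambda>_. n)"]) (auto simp: split_sum_all)
qed

text \<open>Adjacent vertices have distinct images, so a homomorphism between cliques is injective
  on vertices.\<close>

lemma hom_clique_le:
  assumes "graph_hom_exists (clique m) (clique n)"
  shows "m \<le> n"
proof -
  obtain f where f: "\<forall>v \<in> {..<m}. f v \<in> {..<n}" "\<forall>(i, j) \<in> parcs (clique m). (f i, f j) \<in> parcs (clique n)"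
    using assms unfolding graph_hom_exists_def by auto
  then have "inj_on f {..<m}" by (force simp: inj_on_def)
  with f(1) have "card {..<m} \<le> card {..<n}" by (intro card_inj_on_le[of f]) auto
  then show ?thesis by simp
qed

lemma hom_into_clique:
  assumes "pair_graph G"
  shows "\<exists>n. graph_hom_exists G (clique n)"
proof -
  obtain f :: "'a \<Rightarrow> nat" and n where f: "f ` pverts G = {i. i < n}" "inj_on f (pverts G)"
    using finite_imp_inj_to_nat_seg[of "pverts G"] assms by (auto simp: pair_graph_iff)
  have "u \<noteq> v" if "(u, v) \<in> parcs G" for u v using assms that by (auto simp: pair_graph_iff)
  then have "graph_hom_exists G (clique n)"
    using f arcs_verts[OF assms]
    by (intro graph_hom_existsI[where f = f]) (auto simp: inj_on_def, blast+)
  then show ?thesis by blast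
qed

\<comment> \<open>The semiring of graph classes\<close>
\<comment> \<open>The relation is partial because the record type also contains non-graphs. Vertices
  in \<open>nat\<close> suffice, since every finite graph has a copy there.\<close>
quotient_type hgraph = "nat pair_pre_digraph" / partial:
  "\<lambda>G H. pair_graph G \<and> pair_graph H \<and> hom_equiv G H"
proof (rule part_equivpI)
  show "\<exists>G. pair_graph G \<and> pair_graph G \<and> hom_equiv G (G :: nat pair_pre_digraph)"
    using pair_graph_clique hom_equiv_refl by blast
qed (auto intro!: sympI transpI dest: hom_equiv_sym intro: hom_equiv_trans)

text \<open>Passing through \<open>nat_copy\<close> gives graphs over any vertex type a class in the
  single type \<open>hgraph\<close>.\<close>

definition hclass :: "'a pair_pre_digraph \<Rightarrow> hgraph" where
  "hclass G = abs_hgraph (nat_copy G)"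

lemma rep_hgraph: "pair_graph (rep_hgraph x)"
  using Quotient_rep_reflp[OF Quotient_hgraph] by blast

lemma hclass_eq_iff:
  assumes "pair_graph G" "pair_graph H"
  shows "hclass G = hclass H \<longleftrightarrow> hom_equiv G H"
proof -
  have "hclass G = hclass H \<longleftrightarrow> hom_equiv (nat_copy G) (nat_copy H)"
    using Quotient_rel[OF Quotient_hgraph, of "nat_copy G" "nat_copy H"] nat_copy(1)[OF assms(1)]
      nat_copy(1)[OF assms(2)] by (simp add: hclass_def hom_equiv_refl)
  also have "\<dots> \<longleftrightarrow> hom_equiv G H"
    using hom_equiv_nat_copy[OF assms(1)] hom_equiv_nat_copy[OF assms(2)]
    by (auto intro: hom_equiv_trans hom_equiv_sym)
  finally show ?thesis .
qed

lemma rep_hclass: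
  assumes "pair_graph G"
  shows "hom_equiv (rep_hgraph (hclass G)) G"
proof -
  have "hom_equiv (rep_hgraph (abs_hgraph (nat_copy G))) (nat_copy G)"
    using Quotient_rep_abs[OF Quotient_hgraph, of "nat_copy G"] nat_copy(1)[OF assms]
    by (simp add: hom_equiv_refl)
  then show ?thesis
    unfolding hclass_def by (rule hom_equiv_trans[OF _ hom_equiv_nat_copy[OF assms]])
qed

lemma hgraph_cases:
  obtains G :: "nat pair_pre_digraph" where "pair_graph G" "x = hclass G"
proof
  show "pair_graph (rep_hgraph x)" by (rule rep_hgraph)
  have "abs_hgraph (rep_hgraph x) = abs_hgraph (nat_copy (rep_hgraph x))"
    using Quotient_rel[OF Quotient_hgraph, of "rep_hgraph x" "nat_copy (rep_hgraph x)"]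
      hom_equiv_refl rep_hgraph nat_copy(1) hom_equiv_sym[OF hom_equiv_nat_copy] by blast
  then show "x = hclass (rep_hgraph x)"
    by (simp add: hclass_def Quotient_abs_rep[OF Quotient_hgraph])
qed

instantiation hgraph :: comm_semiring_1
begin

definition zero_hgraph :: hgraph where "0 = hclass (clique 0)"
definition one_hgraph :: hgraph where "1 = hclass (clique (Suc 0))"
definition plus_hgraph :: "hgraph \<Rightarrow> hgraph \<Rightarrow> hgraph" where
  "x + y = hclass (graph_join (rep_hgraph x) (rep_hgraph y))"
definition times_hgraph :: "hgraph \<Rightarrow> hgraph \<Rightarrow> hgraph" where
  "x * y = hclass (disj_prod (rep_hgraph x) (rep_hgraph y))"

lemma hclass_join:
  assumes "pair_graph G" "pair_graph H"
  shows "hclass (graph_join G H) = hclass G + hclass H"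
  using assms rep_hgraph hom_equiv_sym[OF hom_equiv_join[OF rep_hclass rep_hclass]]
  by (simp add: plus_hgraph_def hclass_eq_iff pair_graph_join)

lemma hclass_disj_prod:
  assumes "pair_graph G" "pair_graph H"
  shows "hclass (disj_prod G H) = hclass G * hclass H"
  using assms rep_hgraph hom_equiv_sym[OF hom_equiv_disj_prod[OF rep_hclass rep_hclass]]
  by (simp add: times_hgraph_def hclass_eq_iff pair_graph_disj_prod)

instance
proof
  \<comment> \<open>Each semiring equation becomes a pair of homomorphisms, one in each direction,
    given by rearranging the vertices of joins and products.\<close>
  note rules = hclass_join[symmetric] hclass_disj_prod[symmetric] pair_graph_join pair_graph_disj_prod
    hclass_eq_iff zero_hgraph_def one_hgraph_def hom_equiv_def
  fix x y z :: hgraph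
  obtain A :: "nat pair_pre_digraph" where A: "pair_graph A" "x = hclass A" by (rule hgraph_cases[of x])
  obtain B :: "nat pair_pre_digraph" where B: "pair_graph B" "y = hclass B" by (rule hgraph_cases[of y])
  obtain C :: "nat pair_pre_digraph" where C: "pair_graph C" "z = hclass C" by (rule hgraph_cases[of z])
  note [simp] = A B C
  show "x + y + z = x + (y + z)"
    apply (simp add: rules, rule conjI)
    subgoal by (rule graph_hom_existsI[where f = "case_sum (case_sum Inl (Inr \<circ> Inl)) (Inr \<circ> Inr)"])
        (auto simp: split_sum_all)
    subgoal by (rule graph_hom_existsI[where f = "case_sum (Inl \<circ> Inl) (case_sum (Inl \<circ> Inr) Inr)"])
        (auto simp: split_sum_all)
    done
  show "x + y = y + x"
    by (simp add: rules, intro conjI; rule graph_hom_existsI[where f = "case_sum Inr Inl"])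
      (auto simp: split_sum_all)
  show "0 + x = x"
    apply (simp add: rules, rule conjI)
    subgoal by (rule graph_hom_existsI[where f = "case_sum undefined id"]) (auto simp: split_sum_all)
    subgoal by (rule graph_hom_existsI[where f = Inr]) auto
    done
  show "x * y * z = x * (y * z)"
    apply (simp add: rules, rule conjI)
    subgoal by (rule graph_hom_existsI[where f = "\<lambda>((u, v), w). (u, v, w)"]) auto
    subgoal by (rule graph_hom_existsI[where f = "\<lambda>(u, v, w). ((u, v), w)"]) auto
    done
  show "x * y = y * x"
    by (simp add: rules, intro conjI; rule graph_hom_existsI[where f = "\<lambda>(u, v). (v, u)"]) auto
  show "1 * x = x"
    apply (simp add: rules, rule conjI)
    subgoal by (rule graph_hom_existsI[where f = snd]) auto
    subgoal using arcs_verts[OF A(1)] by (intro graph_hom_existsI[where f = "Pair 0"]) auto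
    done
  show "(x + y) * z = x * z + y * z"
    apply (simp add: rules, rule conjI)
    subgoal by (rule graph_hom_existsI[where f = "\<lambda>(v, w). case v of Inl a \<Rightarrow> Inl (a, w) | Inr b \<Rightarrow> Inr (b, w)"])
        (auto simp: split_sum_all)
    subgoal by (rule graph_hom_existsI[where f = "case_sum (\<lambda>(a, w). (Inl a, w)) (\<lambda>(b, w). (Inr b, w))"])
        (auto simp: split_sum_all)
    done
  \<comment> \<open>All graphs involved have no vertices, so any map is a homomorphism.\<close>
  show "0 * x = 0" "x * 0 = 0"
    by (simp_all add: rules, (intro conjI; rule graph_hom_existsI[where f = undefined]; auto)+)
  show "(0 :: hgraph) \<noteq> 1"
    using hom_clique_le[of 1 0] by (auto simp: rules)
qed

end

lemma hclass_clique: "hclass (clique n) = of_nat n"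
proof (induction n)
  case (Suc n)
  have "hclass (clique (Suc n)) = hclass (graph_join (clique n) (clique 1))"
    using hom_equiv_clique_Suc by (simp add: hclass_eq_iff pair_graph_join)
  also have "\<dots> = of_nat (Suc n)" by (simp add: hclass_join Suc add.commute flip: one_hgraph_def)
  finally show ?case .
qed (simp add: zero_hgraph_def)

lemma hclass_disj_power:
  assumes "pair_graph G"
  shows "hclass (disj_power G n) = hclass G ^ n"
proof (induction n)
  case 0
  \<comment> \<open>The power with exponent 0 has the empty list as its only vertex and no
    arcs.\<close>
  have "hom_equiv (disj_power G 0) (clique 1)"
    unfolding hom_equiv_def
  proof
    show "graph_hom_exists (disj_power G 0) (clique 1)"
      by (rule graph_hom_existsI[where f = "\<lambda>_. 0"]) (auto simp: disj_power_def)
    show "graph_hom_exists (clique 1) (disj_power G 0)"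
      by (rule graph_hom_existsI[where f = "\<lambda>_. []"]) (auto simp: disj_power_def)
  qed
  then show ?case using assms by (simp add: hclass_eq_iff pair_graph_disj_power one_hgraph_def)
next
  case (Suc n)
  have "hom_equiv (disj_prod G (disj_power G n)) (disj_power G (Suc n))"
    using assms by (intro iso_imp_hom_equiv disj_power_Suc_iso pair_graph_disj_prod pair_graph_disj_power)
  then have "hclass (disj_prod G (disj_power G n)) = hclass (disj_power G (Suc n))"
    using assms by (simp add: hclass_eq_iff pair_graph_disj_prod pair_graph_disj_power)
  then show ?case using assms Suc by (simp add: hclass_disj_prod pair_graph_disj_power)
qed

section \<open>The homomorphism preorder\<close>

definition hom_order :: "hgraph rel" where
  "hom_order = {(x, y). graph_hom_exists (rep_hgraph x) (rep_hgraph y)}"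

lemma hom_order_iff:
  "pair_graph G \<Longrightarrow> pair_graph H \<Longrightarrow> (hclass G, hclass H) \<in> hom_order \<longleftrightarrow> graph_hom_exists G H"
  using graph_hom_exists_cong[OF rep_hclass rep_hclass] by (simp add: hom_order_def)

text \<open>\<open>upper\<close> holds because every graph maps to a clique, \<open>lower\<close>
  because a nonzero class has a vertex, and \<open>not_succ_le\<close> because larger cliques do not
  map to smaller ones.\<close>

interpretation hom_order: strassen_preorder hom_order
proof
  note rules = hclass_join[symmetric] hclass_disj_prod[symmetric] pair_graph_join pair_graph_disj_prod
    hom_order_iff hclass_clique[symmetric]
  show refl: "(x, x) \<in> hom_order" for x
    by (simp add: hom_order_def graph_hom_exists_refl)
  show trans: "(x, z) \<in> hom_order" if "(x, y) \<in> hom_order" "(y, z) \<in> hom_order" for x y z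
    using that graph_hom_exists_trans by (auto simp: hom_order_def)
  show add: "(x + z, y + z) \<in> hom_order" if "(x, y) \<in> hom_order" for x y z
    using that
    by (cases x rule: hgraph_cases; cases y rule: hgraph_cases; cases z rule: hgraph_cases)
      (auto simp: rules intro: graph_hom_exists_join_mono graph_hom_exists_refl)
  show "(x * z, y * z) \<in> hom_order" if "(x, y) \<in> hom_order" for x y z
    using that
    by (cases x rule: hgraph_cases; cases y rule: hgraph_cases; cases z rule: hgraph_cases)
      (auto simp: rules intro: graph_hom_exists_disj_prod_mono graph_hom_exists_refl)
  have zero: "(0, x) \<in> hom_order" for x
    by (cases x rule: hgraph_cases)
      (auto simp: zero_hgraph_def hom_order_iff intro: graph_hom_existsI[where f = undefined])
  then show "(0, 1) \<in> hom_order" .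
  show upper: "\<exists>n. (x, of_nat n) \<in> hom_order" for x
    by (cases x rule: hgraph_cases) (auto simp: rules intro: hom_into_clique)
  show "\<exists>n. (1, of_nat n * x) \<in> hom_order" if "x \<noteq> 0" for x
  proof (cases x rule: hgraph_cases)
    case (1 G)
    have "pverts G \<noteq> {}"
    proof
      assume e: "pverts G = {}"
      then have "parcs G = {}" using 1(1) by (auto simp: pair_graph_iff)
      with e have "hom_equiv G (clique 0)"
        unfolding hom_equiv_def by (auto intro!: graph_hom_existsI[where f = undefined])
      then show False using 1 that by (simp add: zero_hgraph_def hclass_eq_iff)
    qed
    then obtain v where "v \<in> pverts G" by blast
    then have "graph_hom_exists (clique 1) G"
      by (intro graph_hom_existsI[where f = "\<lambda>_. v"]) auto
    then have "(1, x) \<in> hom_order" using 1 by (simp add: one_hgraph_def hom_order_iff)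
    then show ?thesis by (intro exI[of _ 1]) simp
  qed
  show "(x + 1, x) \<notin> hom_order" for x
  proof
    assume *: "(x + 1, x) \<in> hom_order"
    obtain n where n: "(x, of_nat n) \<in> hom_order" using upper by blast
    \<comment> \<open>Iteration puts \<open>x + k\<close> below \<open>x\<close> for every
      \<open>k\<close>; with \<open>x\<close> below \<open>n\<close>, the clique on
      \<open>Suc n\<close> vertices would map to the one on \<open>n\<close>.\<close>
    have k: "(x + of_nat k, x) \<in> hom_order" for k
    proof (induction k)
      case (Suc k)
      from trans[OF add[OF Suc, of 1] *] show ?case by (simp add: algebra_simps)
    qed (simp add: refl)
    have "(of_nat (Suc n), x + of_nat (Suc n)) \<in> hom_order"
      using add[OF zero[of x], of "of_nat (Suc n)"] by simp
    then have "(of_nat (Suc n), of_nat n) \<in> hom_order" using k n trans by blast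
    then have "Suc n \<le> n"
      by (intro hom_clique_le) (simp only: hclass_clique[symmetric] hom_order_iff pair_graph_clique)
    then show False by simp
  qed
qed

text \<open>Constant maps work in both directions. This reduces an edgeless \<open>H\<close> to the
  rate at \<open>1\<close>.\<close>

lemma hclass_eq_one:
  assumes "pair_graph G" "pverts G \<noteq> {}" "parcs G = {}"
  shows "hclass G = 1"
proof -
  obtain v where "v \<in> pverts G" using assms by blast
  then have "hom_equiv G (clique 1)"
    unfolding hom_equiv_def using assms(3)
    by (auto intro: graph_hom_existsI[where f = "\<lambda>_. 0"] graph_hom_existsI[where f = "\<lambda>_. v"])
  then show ?thesis using assms by (simp add: one_hgraph_def hclass_eq_iff)
qed

text \<open>An edge with its two orientations is a copy of the clique on two vertices; in this form
  edges enter the abstract argument.\<close>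

lemma two_le_hclass:
  assumes G: "pair_graph G" and e: "parcs G \<noteq> {}"
  shows "(2, hclass G) \<in> hom_order"
proof -
  obtain u v where uv: "(u, v) \<in> parcs G" using e by auto
  then have vu: "(v, u) \<in> parcs G" using G by (auto simp: pair_graph_iff sym_def)
  have "graph_hom_exists (clique 2) G"
    using uv vu arcs_verts[OF G]
    by (intro graph_hom_existsI[where f = "\<lambda>i. if i = 0 then u else v"]) (auto simp: less_2_cases_iff)
  then have "(of_nat 2, hclass G) \<in> hom_order"
    using G by (simp add: hom_order_iff flip: hclass_clique)
  then show ?thesis by simp
qed

lemma hom_rate_eq_rate:
  assumes "pair_graph G" "pair_graph H"
  shows "hom_rate G H = hom_order.rate (hclass G) (hclass H)"
proof -
  have "(hclass H ^ m, hclass G ^ n) \<in> hom_order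
      \<longleftrightarrow> graph_hom_exists (disj_power H m) (disj_power G n)" for m n
    using hom_order_iff[OF pair_graph_disj_power[OF assms(2)] pair_graph_disj_power[OF assms(1)]]
    by (simp only: hclass_disj_power assms)
  then show ?thesis unfolding hom_rate_def hom_order.rate_def by (simp only:)
qed

section \<open>Invariants as monotone homomorphisms\<close>

lemma complete_1_hclass:
  assumes "complete_digraph 1 (with_proj G)"
  shows "pair_graph G" "hclass G = 1"
proof -
  have *: "finite (pverts G)" "card (pverts G) = 1"
    "parcs G = {(u,v). (u,v) \<in> (pverts G \<times> pverts G) \<and> u \<noteq> v}"
    using assms unfolding complete_digraph_pair_def by blast+
  then obtain v where "pverts G = {v}" by (auto simp: card_1_singleton_iff)
  with * have v: "pverts G = {v}" "parcs G = {}" by auto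
  then show G: "pair_graph G" by (simp add: pair_graph_iff sym_def)
  show "hclass G = 1" using v by (intro hclass_eq_one G) auto
qed

text \<open>From homomorphisms to invariants: composition with \<open>hclass\<close> respects
  isomorphism, since isomorphic graphs have the same class.\<close>

lemma semiring_hom_invariant_hclass:
  assumes "monotone_hom hom_order \<phi>"
  shows "semiring_hom_invariant (\<phi> \<circ> hclass)"
    and "pair_graph G \<Longrightarrow> inv_value (\<phi> \<circ> hclass) G = \<phi> (hclass G)"
proof -
  interpret monotone_hom hom_order \<phi> by fact
  have copy: "hclass (nat_copy G) = hclass G" if "pair_graph G" for G :: "'c pair_pre_digraph"
    using that hom_equiv_nat_copy[OF that] nat_copy(1)[OF that] by (simp add: hclass_eq_iff)
  show "inv_value (\<phi> \<circ> hclass) G = \<phi> (hclass G)" if "pair_graph G"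
    using copy[OF that] by (simp add: inv_value_def)
  show "semiring_hom_invariant (\<phi> \<circ> hclass)"
  proof
    fix G H :: "nat pair_pre_digraph"
    show "(\<phi> \<circ> hclass) G = (\<phi> \<circ> hclass) H"
      if "pair_graph G" "pair_graph H" "digraph_iso (with_proj G) (with_proj H)"
      using that iso_imp_hom_equiv[OF that] by (simp flip: hclass_eq_iff)
    show "(\<phi> \<circ> hclass) G = 1" if "complete_digraph 1 (with_proj G)"
      using complete_1_hclass(2)[OF that] hom_of_nat[of 1] by simp
  qed (simp_all add: hom_nonneg hom_mono hom_order_iff inv_value_def copy pair_graph_join
      pair_graph_disj_prod hclass_join hclass_disj_prod hom_add hom_mult)
qed

context semiring_hom_invariant
begin

lemma hom_equiv_value: "pair_graph G \<Longrightarrow> pair_graph H \<Longrightarrow> hom_equiv G H \<Longrightarrow> \<eta> G = \<eta> H"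
  using hom_mono by (auto simp: hom_equiv_def intro: antisym)

lemma rep_hgraph_hclass_value:
  assumes "pair_graph G"
  shows "\<eta> (rep_hgraph (hclass G)) = inv_value \<eta> G"
proof -
  have "hom_equiv (rep_hgraph (hclass G)) (nat_copy G)"
    by (intro hom_equiv_trans[OF rep_hclass] hom_equiv_sym[OF hom_equiv_nat_copy] assms)
  then show ?thesis
    unfolding inv_value_def by (intro hom_equiv_value rep_hgraph nat_copy(1) assms)
qed

text \<open>From invariants to homomorphisms: monotonicity makes \<open>\<eta>\<close> constant on
  each class, so its value at the chosen representative is that of any other member.\<close>

lemma monotone_hom_rep_hgraph: "monotone_hom hom_order (\<eta> \<circ> rep_hgraph)"
proof -
  have add: "\<eta> (rep_hgraph (x + y)) = \<eta> (rep_hgraph x) + \<eta> (rep_hgraph y)" for x y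
    unfolding plus_hgraph_def
    by (simp add: rep_hgraph_hclass_value rep_hgraph pair_graph_join join)
  have mult: "\<eta> (rep_hgraph (x * y)) = \<eta> (rep_hgraph x) * \<eta> (rep_hgraph y)" for x y
    unfolding times_hgraph_def
    by (simp add: rep_hgraph_hclass_value rep_hgraph pair_graph_disj_prod disj)
  have "complete_digraph 1 (with_proj (clique 1))"
    unfolding complete_digraph_pair_def by (auto simp: clique_def)
  then have one: "\<eta> (rep_hgraph 1) = 1"
    using hom_equiv_value[OF rep_hgraph pair_graph_clique rep_hclass[OF pair_graph_clique], of 1] K1
    by (simp add: one_hgraph_def)
  \<comment> \<open>Additivity at \<open>0 + 0\<close> forces the value 0 at the zero class, which
    is the base case.\<close>
  have of_nat: "\<eta> (rep_hgraph (of_nat n)) = real n" for n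
    using add[of 0 0] by (induction n) (simp_all add: add one)
  show ?thesis
    by unfold_locales (auto simp: add mult of_nat nonneg rep_hgraph hom_order_def intro: hom_mono)
qed

end

text \<open>The passages between invariants and homomorphisms preserve the values at
  \<open>G\<close> and \<open>H\<close>, so both infima range over the same pairs of values.\<close>

lemma INF_invariant_eq:
  assumes G: "pair_graph G" and H: "pair_graph H"
  shows "(INF \<eta> \<in> {\<eta>. semiring_hom_invariant \<eta>}. F (inv_value \<eta> G) (inv_value \<eta> H))
    = (INF \<phi> \<in> {\<phi>. monotone_hom hom_order \<phi>}. F (\<phi> (hclass G)) (\<phi> (hclass H)) :: ereal)"
proof (rule INF_eq)
  fix \<eta> assume "\<eta> \<in> {\<eta>. semiring_hom_invariant \<eta>}"
  then interpret semiring_hom_invariant \<eta> by simp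
  show "\<exists>\<phi>\<in>{\<phi>. monotone_hom hom_order \<phi>}.
      F (\<phi> (hclass G)) (\<phi> (hclass H)) \<le> F (inv_value \<eta> G) (inv_value \<eta> H)"
    using monotone_hom_rep_hgraph rep_hgraph_hclass_value[OF G] rep_hgraph_hclass_value[OF H]
    by (intro bexI[of _ "\<eta> \<circ> rep_hgraph"]) simp_all
next
  fix \<phi> assume "\<phi> \<in> {\<phi>. monotone_hom hom_order \<phi>}"
  then have "monotone_hom hom_order \<phi>" by simp
  note inv = semiring_hom_invariant_hclass[OF this]
  show "\<exists>\<eta>\<in>{\<eta>. semiring_hom_invariant \<eta>}.
      F (inv_value \<eta> G) (inv_value \<eta> H) \<le> F (\<phi> (hclass G)) (\<phi> (hclass H))"
    using inv(1) inv(2)[OF G] inv(2)[OF H] by (intro bexI[of _ "\<phi> \<circ> hclass"]) simp_all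
qed

theorem theorem2p7:
  fixes G :: "'a pair_pre_digraph" and H :: "'b pair_pre_digraph"
  assumes "pair_graph G" and "pair_graph H"
    and "parcs G \<noteq> {}" and "pverts H \<noteq> {}"
  shows "hom_rate G H =
    (INF \<eta> \<in> {\<eta>. semiring_hom_invariant \<eta>}.
       ereal (ln (inv_value \<eta> G)) / ereal (ln (inv_value \<eta> H)))"
proof -
  note g = two_le_hclass[OF assms(1,3)]
  have "hom_order.rate (hclass G) (hclass H) = (INF \<phi> \<in> {\<phi>. monotone_hom hom_order \<phi>}.
      ereal (ln (\<phi> (hclass G))) / ereal (ln (\<phi> (hclass H))))"
  \<comment> \<open>Without arcs \<open>H\<close> has class \<open>1\<close>; otherwise
    \<open>2\<close> lies below its class, as \<open>rate_eq_INF\<close> requires.\<close>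
  proof (cases "parcs H = {}")
    case True
    then show ?thesis
      using hom_order.rate_one_eq_INF[OF g] hclass_eq_one[OF assms(2,4)] by simp
  next
    case False
    then show ?thesis by (intro hom_order.rate_eq_INF g two_le_hclass assms)
  qed
  then show ?thesis
    using INF_invariant_eq[OF assms(1,2), of "\<lambda>x y. ereal (ln x) / ereal (ln y)"]
      hom_rate_eq_rate[OF assms(1,2)] by simp
qed

end
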